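(* For every $f\in\operatorname{Dom}\mathcal E$ and every $t\ge 0$, $$\partial e^{t\Delta}f=e^{t\vec\Delta}\,\partial f .$$
   Context: Setting. $(X,d)$ is a locally compact separable metric space and $\mu$ is a locally finite Borel measure on $X$ with $\mu(U)>0$ for every nonempty open $U$. $(\mathcal E,\operatorname{Dom}\mathcal E)$ is a symmetric, strictly local (i.e. strongly local: $\mathcal E(f,g)=0$ whenever $f,g\in\operatorname{Dom}\mathcal E$ have compact support and $g$ is constant on a neighbourhood of $\operatorname{supp} f$), regular Dirichlet form on $L^2(X,\mu)$. It admits a carré du champ $\Gamma$: a symmetric bilinear positive map $\operatorname{Dom}\mathcal E\times\operatorname{Dom}\mathcal E\to L^1(X,\mu)$ with $\mathcal E(f,g)=\int\Gamma(f,g)\,d\mu$ and $2\int h\,\Gamma(f,g)\,d\mu=\mathcal E(fh,g)+\mathcal E(gh,f)-\mathcal E(fg,h)$ for bounded $f,g,h\in\operatorname{Dom}\mathcal E$. $\Delta$ is the nonpositive self-adjoint generator: $\mathcal E(u,v)=-\int v\,\Delta u\,d\mu$ for $u\in\operatorname{Dom}\Delta$, $v\in\operatorname{Dom}\mathcal E$. One-forms. Let $\mathcal B_b(X)$ be the bounded Borel functions and $\mathcal C=C_b(X)\cap\operatorname{Dom}\mathcal E$. $\mathcal H$ is the Hilbert space obtained from $\mathcal C\otimes\mathcal B_b(X)$ with the nonnegative form $\langle f_1\otimes g_1,f_2\otimes g_2\rangle_{\mathcal H}=\int g_1g_2\,\Gamma(f_1,f_2)\,d\mu$ by quotienting out the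 zero-seminorm elements and completing. The exterior derivative is $\partial f=f\otimes\mathbf 1$ for $f\in\mathcal C$, extended to a closed densely defined operator $\partial:L^2(X,\mu)\to\mathcal H$ with $\operatorname{Dom}\partial=\operatorname{Dom}\mathcal E$; thus $\langle\partial f,\partial g\rangle_{\mathcal H}=\mathcal E(f,g)$. $\partial^*:\mathcal H\to L^2(X,\mu)$ is its adjoint. The one-form Laplacian is the self-adjoint operator $\vec\Delta=-\partial\partial^*$ on $\mathcal H$, with $\operatorname{Dom}\vec\Delta=\{\eta\in\operatorname{Dom}\partial^*:\partial^*\eta\in\operatorname{Dom}\partial\}$. *)

theory Defs
  imports "HOL-Analysis.Analysis"
begin

text \<open>
  Unbounded operators are represented by their graphs, so that the domain of an operator \<open>A\<close>
  is \<^term>\<open>Domain A\<close>.  Only \<open>op_app\<close> presupposes that the graph is single-valued.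
\<close>

definition op_app :: "('a \<times> 'b) set \<Rightarrow> 'a \<Rightarrow> 'b" where
  "op_app A x = (THE y. (x, y) \<in> A)"

definition op_adjoint :: "('a::real_inner \<times> 'b::real_inner) set \<Rightarrow> ('b \<times> 'a) set" where
  "op_adjoint A = {(y, z). \<forall>(x, w)\<in>A. inner w y = inner x z}"

text \<open>Only the values at times \<open>t \<ge> 0\<close> matter.\<close>

definition C0_semigroup :: "(real \<Rightarrow> 'a::real_normed_vector \<Rightarrow> 'a) \<Rightarrow> bool" where
  "C0_semigroup T \<longleftrightarrow>
     (\<forall>t\<ge>0. bounded_linear (T t)) \<and>
     T 0 = id \<and>
     (\<forall>s\<ge>0. \<forall>t\<ge>0. T (s + t) = T s \<circ> T t) \<and>
     (\<forall>x. ((\<lambda>t. T t x) \<longlongrightarrow> x) (at_right 0))"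

definition generator :: "(real \<Rightarrow> 'a::real_normed_vector \<Rightarrow> 'a) \<Rightarrow> ('a \<times> 'a) set" where
  "generator T = {(x, y). ((\<lambda>h. (T h x - x) /\<^sub>R h) \<longlongrightarrow> y) (at_right 0)}"

text \<open>
  \<open>op_exp t A\<close> is \<open>e\<^sup>t\<^sup>A\<close>: the time \<open>t\<close> map of the strongly continuous semigroup whose
  infinitesimal generator is exactly \<open>A\<close> (equal domains included).  The semigroup is determined by
  \<open>A\<close> for \<open>t \<ge> 0\<close>; it exists if \<open>A\<close> is self-adjoint and nonpositive.
\<close>

definition op_exp :: "real \<Rightarrow> ('a::real_normed_vector \<times> 'a) set \<Rightarrow> 'a \<Rightarrow> 'a" where
  "op_exp t A = (THE S. \<exists>T. C0_semigroup T \<and> generator T = A \<and> S = T t)"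


definition sq_integrable :: "'x measure \<Rightarrow> ('x \<Rightarrow> real) set" where
  "sq_integrable M = {f \<in> borel_measurable M. integrable M (\<lambda>x. (f x)\<^sup>2)}"

text \<open>The support of the (signed) measure \<open>f \<mu>\<close>; it depends only on the a.e. class of \<open>f\<close>.\<close>

definition ess_support :: "'x::topological_space measure \<Rightarrow> ('x \<Rightarrow> real) \<Rightarrow> 'x set" where
  "ess_support M f = {x. \<forall>U. open U \<longrightarrow> x \<in> U \<longrightarrow> \<not> (AE y in M. y \<in> U \<longrightarrow> f y = 0)}"

definition bounded_borel :: "('x::topological_space \<Rightarrow> real) set" where
  "bounded_borel = {g \<in> borel_measurable borel. bounded (range g)}"

definition Cc :: "('x::topological_space \<Rightarrow> real) set" where
  "Cc = {f. continuous_on UNIV f \<and> compact (closure {x. f x \<noteq> 0})}"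

locale metric_measure_space =
  fixes M :: "'x::metric_space measure"
  assumes locally_compact: "locally compact (UNIV :: 'x set)"
    and separable: "\<exists>A :: 'x set. countable A \<and> closure A = UNIV"
    and sets_M: "sets M = sets borel"
    and locally_finite: "\<exists>U. open U \<and> x \<in> U \<and> emeasure M U < \<infinity>"
    and full_support: "open U \<Longrightarrow> U \<noteq> {} \<Longrightarrow> emeasure M U > 0"

text \<open>
  The Hilbert space \<open>L\<^sup>2(X,\<mu>)\<close> is a type \<open>'l\<close> together with the quotient map \<open>cls\<close> sending a square
  integrable function to its a.e. class.  The two assumptions imply that \<open>cls\<close> is linear
  (see below) and that \<open>cls f = cls g\<close> iff \<open>f = g\<close> a.e.
\<close>

locale L2_space = metric_measure_space M
  for M :: "'x::metric_space measure" +
  fixes cls :: "('x \<Rightarrow> real) \<Rightarrow> 'l::{real_inner, complete_space}"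
  assumes cls_onto: "cls ` sq_integrable M = UNIV"
    and inner_cls: "\<lbrakk>f \<in> sq_integrable M; g \<in> sq_integrable M\<rbrakk>
          \<Longrightarrow> inner (cls f) (cls g) = (\<integral>x. f x * g x \<partial>M)"

definition energy1 :: "('l::real_inner \<Rightarrow> 'l \<Rightarrow> real) \<Rightarrow> 'l \<Rightarrow> real" where
  "energy1 E u = E u u + inner u u"

text \<open>
  A symmetric Dirichlet form \<open>E\<close> with domain \<open>D\<close>.  Values of \<open>E\<close> outside \<open>D \<times> D\<close> are irrelevant.
\<close>

locale dirichlet_form = L2_space M cls
  for M :: "'x::metric_space measure"
    and cls :: "('x \<Rightarrow> real) \<Rightarrow> 'l::{real_inner, complete_space}" +
  fixes D :: "'l set"
    and E :: "'l \<Rightarrow> 'l \<Rightarrow> real"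
  assumes subspace_D: "subspace D"
    and dense_D: "closure D = UNIV"
    and E_add: "\<lbrakk>u \<in> D; v \<in> D; w \<in> D\<rbrakk> \<Longrightarrow> E (u + v) w = E u w + E v w"
    and E_scale: "\<lbrakk>u \<in> D; w \<in> D\<rbrakk> \<Longrightarrow> E (a *\<^sub>R u) w = a * E u w"
    and E_sym: "\<lbrakk>u \<in> D; v \<in> D\<rbrakk> \<Longrightarrow> E u v = E v u"
    and E_nonneg: "u \<in> D \<Longrightarrow> E u u \<ge> 0"
    and E_closed: "\<lbrakk>\<And>n. s n \<in> D; \<And>e. e > 0 \<Longrightarrow> \<exists>N. \<forall>m\<ge>N. \<forall>n\<ge>N. energy1 E (s m - s n) < e\<rbrakk>
          \<Longrightarrow> \<exists>u\<in>D. (\<lambda>n :: nat. energy1 E (s n - u)) \<longlonglongrightarrow> 0"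
    and E_markov: "\<lbrakk>f \<in> sq_integrable M; cls f \<in> D\<rbrakk>
          \<Longrightarrow> cls (\<lambda>x. min 1 (max 0 (f x))) \<in> D \<and>
              E (cls (\<lambda>x. min 1 (max 0 (f x)))) (cls (\<lambda>x. min 1 (max 0 (f x)))) \<le> E (cls f) (cls f)"

locale strongly_local_regular_form = dirichlet_form M cls D E
  for M :: "'x::metric_space measure"
    and cls :: "('x \<Rightarrow> real) \<Rightarrow> 'l::{real_inner, complete_space}"
    and D E +
  assumes strongly_local:
      "\<lbrakk>f \<in> sq_integrable M; cls f \<in> D; compact (ess_support M f);
        g \<in> sq_integrable M; cls g \<in> D; compact (ess_support M g);
        open U; ess_support M f \<subseteq> U; AE x in M. x \<in> U \<longrightarrow> g x = c\<rbrakk>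
       \<Longrightarrow> E (cls f) (cls g) = 0"
    and regular_sup: "\<lbrakk>f \<in> Cc; e > 0\<rbrakk> \<Longrightarrow> \<exists>g\<in>Cc. cls g \<in> D \<and> (\<forall>x. \<bar>f x - g x\<bar> < e)"
    and regular_energy: "\<lbrakk>u \<in> D; e > 0\<rbrakk> \<Longrightarrow> \<exists>g\<in>Cc. cls g \<in> D \<and> energy1 E (u - cls g) < e"

text \<open>
  The elements \<open>\<Gamma> u v\<close> of \<open>L\<^sup>1(X,\<mu>)\<close> are given by representing functions, hence the algebraic
  properties of \<open>\<Gamma>\<close> hold a.e.
\<close>

locale carre_du_champ = strongly_local_regular_form M cls D E
  for M :: "'x::metric_space measure"
    and cls :: "('x \<Rightarrow> real) \<Rightarrow> 'l::{real_inner, complete_space}"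
    and D E +
  fixes \<Gamma> :: "'l \<Rightarrow> 'l \<Rightarrow> 'x \<Rightarrow> real"
  assumes \<Gamma>_integrable: "\<lbrakk>u \<in> D; v \<in> D\<rbrakk> \<Longrightarrow> integrable M (\<Gamma> u v)"
    and \<Gamma>_sym: "\<lbrakk>u \<in> D; v \<in> D\<rbrakk> \<Longrightarrow> AE x in M. \<Gamma> u v x = \<Gamma> v u x"
    and \<Gamma>_add: "\<lbrakk>u \<in> D; v \<in> D; w \<in> D\<rbrakk> \<Longrightarrow> AE x in M. \<Gamma> (u + v) w x = \<Gamma> u w x + \<Gamma> v w x"
    and \<Gamma>_scale: "\<lbrakk>u \<in> D; w \<in> D\<rbrakk> \<Longrightarrow> AE x in M. \<Gamma> (a *\<^sub>R u) w x = a * \<Gamma> u w x"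
    and \<Gamma>_nonneg: "u \<in> D \<Longrightarrow> AE x in M. \<Gamma> u u x \<ge> 0"
    and E_eq_\<Gamma>: "\<lbrakk>u \<in> D; v \<in> D\<rbrakk> \<Longrightarrow> E u v = (\<integral>x. \<Gamma> u v x \<partial>M)"
    and \<Gamma>_product: "\<lbrakk>f \<in> sq_integrable M; bounded (range f); cls f \<in> D;
         g \<in> sq_integrable M; bounded (range g); cls g \<in> D;
         h \<in> sq_integrable M; bounded (range h); cls h \<in> D\<rbrakk>
        \<Longrightarrow> 2 * (\<integral>x. h x * \<Gamma> (cls f) (cls g) x \<partial>M) =
            E (cls (\<lambda>x. f x * h x)) (cls g) + E (cls (\<lambda>x. g x * h x)) (cls f)
            - E (cls (\<lambda>x. f x * g x)) (cls h)"

text \<open>The space \<open>C\<^sub>b(X) \<inter> Dom E\<close>; as \<open>\<mu>\<close> has full support, its members are determined by their classes.\<close>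

definition Cb_dom :: "'x::metric_space measure \<Rightarrow> (('x \<Rightarrow> real) \<Rightarrow> 'l) \<Rightarrow> 'l set \<Rightarrow> ('x \<Rightarrow> real) set" where
  "Cb_dom M cls D =
     {f. continuous_on UNIV f \<and> bounded (range f) \<and> f \<in> sq_integrable M \<and> cls f \<in> D}"

text \<open>
  The Hilbert space of one-forms is a type \<open>'h\<close> together with the canonical map
  \<open>(f, g) \<mapsto> f \<otimes> g\<close> into the Hausdorff completion.  The formula for the inner product makes \<open>tens\<close>
  bilinear (see below), so it induces an isometric linear map on the algebraic tensor product
  (isometric with respect to the seminorm there) whose range is the span in \<open>tens_dense\<close>; being
  complete and having this range as a dense subspace, \<open>'h\<close> is the completion of the quotient by
  the zero-seminorm elements.
\<close>

locale one_forms = carre_du_champ M cls D E \<Gamma>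
  for M :: "'x::metric_space measure"
    and cls :: "('x \<Rightarrow> real) \<Rightarrow> 'l::{real_inner, complete_space}"
    and D E \<Gamma> +
  fixes tens :: "('x \<Rightarrow> real) \<Rightarrow> ('x \<Rightarrow> real) \<Rightarrow> 'h::{real_inner, complete_space}"
  assumes inner_tens:
      "\<lbrakk>f\<^sub>1 \<in> Cb_dom M cls D; g\<^sub>1 \<in> bounded_borel; f\<^sub>2 \<in> Cb_dom M cls D; g\<^sub>2 \<in> bounded_borel\<rbrakk>
       \<Longrightarrow> inner (tens f\<^sub>1 g\<^sub>1) (tens f\<^sub>2 g\<^sub>2) = (\<integral>x. g\<^sub>1 x * g\<^sub>2 x * \<Gamma> (cls f\<^sub>1) (cls f\<^sub>2) x \<partial>M)"
    and tens_dense: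
      "closure (span {tens f g | f g. f \<in> Cb_dom M cls D \<and> g \<in> bounded_borel}) = UNIV"


definition laplacian :: "'l::real_inner set \<Rightarrow> ('l \<Rightarrow> 'l \<Rightarrow> real) \<Rightarrow> ('l \<times> 'l) set" where
  "laplacian D E = {(u, w). u \<in> D \<and> (\<forall>v\<in>D. E u v = - inner v w)}"

text \<open>The closure of \<open>f \<mapsto> f \<otimes> 1\<close> on \<open>C\<^sub>b(X) \<inter> Dom E\<close> as an operator from \<open>L\<^sup>2\<close> to the one-forms.\<close>

definition ext_deriv :: "'x::metric_space measure \<Rightarrow> (('x \<Rightarrow> real) \<Rightarrow> 'l::real_inner) \<Rightarrow> 'l set
    \<Rightarrow> (('x \<Rightarrow> real) \<Rightarrow> ('x \<Rightarrow> real) \<Rightarrow> 'h::real_inner) \<Rightarrow> ('l \<times> 'h) set" where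
  "ext_deriv M cls D tens = closure {(cls f, tens f (\<lambda>x. 1)) | f. f \<in> Cb_dom M cls D}"

text \<open>
  \<open>- d d\<^sup>*\<close> for an operator \<open>d\<close>, on the domain of those \<open>\<eta>\<close> in the domain of \<open>d\<^sup>*\<close> for which
  \<open>d\<^sup>* \<eta>\<close> lies in the domain of \<open>d\<close>.
\<close>

definition form_laplacian :: "('l::real_inner \<times> 'h::real_inner) set \<Rightarrow> ('h \<times> 'h) set" where
  "form_laplacian d = {(\<eta>, - \<zeta>) | \<eta> \<zeta>. (\<eta>, \<zeta>) \<in> op_adjoint d O d}"


lemma sq_integrable_mult:
  assumes "f \<in> sq_integrable M" "g \<in> sq_integrable M"
  shows "integrable M (\<lambda>x. f x * g x)"
proof (rule Bochner_Integration.integrable_bound)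
  show "integrable M (\<lambda>x. (f x)\<^sup>2 + (g x)\<^sup>2)"
    using assms by (auto simp: sq_integrable_def)
  show "(\<lambda>x. f x * g x) \<in> borel_measurable M"
    using assms by (auto simp: sq_integrable_def)
  have "\<bar>a * b\<bar> \<le> a\<^sup>2 + b\<^sup>2" for a b :: real
  proof -
    have "2 * (\<bar>a\<bar> * \<bar>b\<bar>) \<le> a\<^sup>2 + b\<^sup>2"
      using sum_squares_bound[of "\<bar>a\<bar>" "\<bar>b\<bar>"] by (simp add: mult.assoc)
    moreover have "0 \<le> \<bar>a\<bar> * \<bar>b\<bar>" by simp
    ultimately show ?thesis unfolding abs_mult by linarith
  qed
  then show "AE x in M. norm (f x * g x) \<le> norm ((f x)\<^sup>2 + (g x)\<^sup>2)" by simp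
qed

lemma sq_integrable_add:
  assumes "f \<in> sq_integrable M" "g \<in> sq_integrable M"
  shows "(\<lambda>x. f x + g x) \<in> sq_integrable M"
  using assms sq_integrable_mult[OF assms]
  by (auto simp: sq_integrable_def power2_sum mult.assoc)

lemma sq_integrable_scale:
  "f \<in> sq_integrable M \<Longrightarrow> (\<lambda>x. a * f x) \<in> sq_integrable M"
  by (auto simp: sq_integrable_def power_mult_distrib)

context L2_space
begin

lemma cls_eqI:
  assumes "\<And>h. h \<in> sq_integrable M \<Longrightarrow> inner u (cls h) = inner v (cls h)"
  shows "u = v"
proof -
  obtain h where h: "h \<in> sq_integrable M" "u - v = cls h"
    using cls_onto by (metis UNIV_I imageE)
  have "inner (u - v) (cls h) = 0"
    using assms[OF h(1)] unfolding inner_diff_left by simp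
  then have "inner (u - v) (u - v) = 0" unfolding h(2) .
  then show ?thesis by simp
qed

lemma cls_add:
  assumes "f \<in> sq_integrable M" "g \<in> sq_integrable M"
  shows "cls (\<lambda>x. f x + g x) = cls f + cls g"
  by (rule cls_eqI)
    (use assms in \<open>simp add: inner_cls inner_add_left sq_integrable_add sq_integrable_mult distrib_right\<close>)

lemma cls_scale:
  assumes "f \<in> sq_integrable M"
  shows "cls (\<lambda>x. a * f x) = a *\<^sub>R cls f"
  by (rule cls_eqI) (use assms in \<open>simp add: inner_cls sq_integrable_scale mult.assoc\<close>)

lemma cls_eq_iff:
  assumes "f \<in> sq_integrable M" "g \<in> sq_integrable M"
  shows "cls f = cls g \<longleftrightarrow> (AE x in M. f x = g x)"
proof -
  define h where "h = (\<lambda>x. f x + (- 1) * g x)"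
  have h: "h \<in> sq_integrable M"
    unfolding h_def by (intro sq_integrable_add sq_integrable_scale assms)
  have "cls h = cls f - cls g"
    unfolding h_def using cls_add[OF assms(1) sq_integrable_scale[OF assms(2)], of "- 1"]
      cls_scale[OF assms(2), of "- 1"] by simp
  then have "cls f = cls g \<longleftrightarrow> inner (cls h) (cls h) = 0" by simp
  also have "\<dots> \<longleftrightarrow> (\<integral>x. (h x)\<^sup>2 \<partial>M) = 0"
    using h by (simp add: inner_cls power2_eq_square)
  also have "\<dots> \<longleftrightarrow> (AE x in M. (h x)\<^sup>2 = 0)"
    using h by (intro integral_nonneg_eq_0_iff_AE) (auto simp: sq_integrable_def)
  also have "\<dots> \<longleftrightarrow> (AE x in M. f x = g x)"
    by (simp add: h_def)
  finally show ?thesis .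
qed

end

context one_forms
begin

lemma tens_integrable:
  assumes "g\<^sub>1 \<in> bounded_borel" "g\<^sub>2 \<in> bounded_borel" "u \<in> D" "v \<in> D"
  shows "integrable M (\<lambda>x. g\<^sub>1 x * g\<^sub>2 x * \<Gamma> u v x)"
proof -
  obtain b\<^sub>1 b\<^sub>2 where b: "\<And>x. \<bar>g\<^sub>1 x\<bar> \<le> b\<^sub>1" "\<And>x. \<bar>g\<^sub>2 x\<bar> \<le> b\<^sub>2"
    using assms by (auto simp: bounded_borel_def bounded_iff)
  have meas: "g\<^sub>1 \<in> borel_measurable M" "g\<^sub>2 \<in> borel_measurable M"
    using assms measurable_cong_sets[OF sets_M refl] by (auto simp: bounded_borel_def)
  show ?thesis
  proof (rule Bochner_Integration.integrable_bound)
    show "integrable M (\<lambda>x. b\<^sub>1 * b\<^sub>2 * \<Gamma> u v x)"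
      using \<Gamma>_integrable assms by simp
    show "(\<lambda>x. g\<^sub>1 x * g\<^sub>2 x * \<Gamma> u v x) \<in> borel_measurable M"
      using meas \<Gamma>_integrable[OF assms(3,4)] by auto
    show "AE x in M. norm (g\<^sub>1 x * g\<^sub>2 x * \<Gamma> u v x) \<le> norm (b\<^sub>1 * b\<^sub>2 * \<Gamma> u v x)"
    proof (rule AE_I2)
      fix x
      have "0 \<le> b\<^sub>1" "0 \<le> b\<^sub>2" using b[of x] by auto
      then have "\<bar>g\<^sub>1 x\<bar> * \<bar>g\<^sub>2 x\<bar> \<le> \<bar>b\<^sub>1\<bar> * \<bar>b\<^sub>2\<bar>"
        using b[of x] by (intro mult_mono) auto
      then show "norm (g\<^sub>1 x * g\<^sub>2 x * \<Gamma> u v x) \<le> norm (b\<^sub>1 * b\<^sub>2 * \<Gamma> u v x)"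
        by (simp add: abs_mult mult_right_mono)
    qed
  qed
qed

lemma tens_eqI:
  assumes "\<And>f g. f \<in> Cb_dom M cls D \<Longrightarrow> g \<in> bounded_borel
             \<Longrightarrow> inner \<eta> (tens f g) = inner \<zeta> (tens f g)"
  shows "\<eta> = \<zeta>"
proof -
  let ?S = "{tens f g | f g. f \<in> Cb_dom M cls D \<and> g \<in> bounded_borel}"
  let ?K = "{\<xi>. inner (\<eta> - \<zeta>) \<xi> = 0}"
  have "closed ?K" by (intro closed_Collect_eq continuous_intros)
  moreover have "span ?S \<subseteq> ?K"
    by (rule span_minimal)
      (use assms in \<open>auto simp: inner_diff_left subspace_def inner_add_right\<close>)
  ultimately have "closure (span ?S) \<subseteq> ?K"
    by (intro closure_minimal)
  then have "UNIV \<subseteq> ?K" unfolding tens_dense .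
  then have "inner (\<eta> - \<zeta>) (\<eta> - \<zeta>) = 0" by blast
  then show ?thesis by simp
qed

lemma Cb_dom_add:
  assumes "f\<^sub>1 \<in> Cb_dom M cls D" "f\<^sub>2 \<in> Cb_dom M cls D"
  shows "(\<lambda>x. f\<^sub>1 x + f\<^sub>2 x) \<in> Cb_dom M cls D"
  using assms subspace_add[OF subspace_D]
  by (auto simp: Cb_dom_def cls_add sq_integrable_add intro!: continuous_intros bounded_plus_comp)

lemma Cb_dom_scale:
  assumes "f \<in> Cb_dom M cls D"
  shows "(\<lambda>x. a * f x) \<in> Cb_dom M cls D"
  using assms subspace_scale[OF subspace_D] bounded_scaling[of "range f" a]
  by (auto simp: Cb_dom_def cls_scale sq_integrable_scale image_image intro!: continuous_intros)

lemma bounded_borel_add: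
  assumes "g\<^sub>1 \<in> bounded_borel" "g\<^sub>2 \<in> bounded_borel"
  shows "(\<lambda>x. g\<^sub>1 x + g\<^sub>2 x) \<in> bounded_borel"
  using assms by (auto simp: bounded_borel_def intro!: bounded_plus_comp)

lemma bounded_borel_scale:
  assumes "g \<in> bounded_borel"
  shows "(\<lambda>x. a * g x) \<in> bounded_borel"
  using assms bounded_scaling[of "range g" a] by (auto simp: bounded_borel_def image_image)

lemma tens_add_left:
  assumes f: "f\<^sub>1 \<in> Cb_dom M cls D" "f\<^sub>2 \<in> Cb_dom M cls D" and g: "g \<in> bounded_borel"
  shows "tens (\<lambda>x. f\<^sub>1 x + f\<^sub>2 x) g = tens f\<^sub>1 g + tens f\<^sub>2 g"
proof (rule tens_eqI)
  fix f' g' :: "'x \<Rightarrow> real" assume f': "f' \<in> Cb_dom M cls D" and g': "g' \<in> bounded_borel"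
  have D: "cls f\<^sub>1 \<in> D" "cls f\<^sub>2 \<in> D" "cls f' \<in> D" "cls f\<^sub>1 + cls f\<^sub>2 \<in> D"
    using f f' subspace_add[OF subspace_D] by (auto simp: Cb_dom_def)
  have "(\<integral>x. g x * g' x * \<Gamma> (cls f\<^sub>1 + cls f\<^sub>2) (cls f') x \<partial>M)
      = (\<integral>x. g x * g' x * \<Gamma> (cls f\<^sub>1) (cls f') x + g x * g' x * \<Gamma> (cls f\<^sub>2) (cls f') x \<partial>M)"
  proof (rule integral_cong_AE)
    show "AE x in M. g x * g' x * \<Gamma> (cls f\<^sub>1 + cls f\<^sub>2) (cls f') x
        = g x * g' x * \<Gamma> (cls f\<^sub>1) (cls f') x + g x * g' x * \<Gamma> (cls f\<^sub>2) (cls f') x"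
      using \<Gamma>_add[OF D(1,2,3)] by eventually_elim (simp add: distrib_left)
  qed (use tens_integrable[OF g g' D(4,3)] tens_integrable[OF g g' D(1,3)]
        tens_integrable[OF g g' D(2,3)] in auto)
  moreover have "cls (\<lambda>x. f\<^sub>1 x + f\<^sub>2 x) = cls f\<^sub>1 + cls f\<^sub>2"
    using f by (auto simp: Cb_dom_def cls_add)
  ultimately show "inner (tens (\<lambda>x. f\<^sub>1 x + f\<^sub>2 x) g) (tens f' g') = inner (tens f\<^sub>1 g + tens f\<^sub>2 g) (tens f' g')"
    using inner_tens[OF Cb_dom_add[OF f] g f' g'] inner_tens[OF f(1) g f' g'] inner_tens[OF f(2) g f' g']
      tens_integrable[OF g g' D(1,3)] tens_integrable[OF g g' D(2,3)]
    by (simp add: inner_add_left)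
qed

lemma tens_scale_left:
  assumes f: "f \<in> Cb_dom M cls D" and g: "g \<in> bounded_borel"
  shows "tens (\<lambda>x. a * f x) g = a *\<^sub>R tens f g"
proof (rule tens_eqI)
  fix f' g' :: "'x \<Rightarrow> real" assume f': "f' \<in> Cb_dom M cls D" and g': "g' \<in> bounded_borel"
  have D: "cls f \<in> D" "cls f' \<in> D" "a *\<^sub>R cls f \<in> D"
    using f f' subspace_scale[OF subspace_D] by (auto simp: Cb_dom_def)
  have "(\<integral>x. g x * g' x * \<Gamma> (a *\<^sub>R cls f) (cls f') x \<partial>M)
      = (\<integral>x. a * (g x * g' x * \<Gamma> (cls f) (cls f') x) \<partial>M)"
  proof (rule integral_cong_AE)
    show "AE x in M. g x * g' x * \<Gamma> (a *\<^sub>R cls f) (cls f') x = a * (g x * g' x * \<Gamma> (cls f) (cls f') x)"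
      using \<Gamma>_scale[OF D(1,2), of a] by eventually_elim simp
  qed (use tens_integrable[OF g g' D(3,2)] tens_integrable[OF g g' D(1,2)] in auto)
  moreover have "cls (\<lambda>x. a * f x) = a *\<^sub>R cls f"
    using f by (auto simp: Cb_dom_def cls_scale)
  ultimately show "inner (tens (\<lambda>x. a * f x) g) (tens f' g') = inner (a *\<^sub>R tens f g) (tens f' g')"
    using inner_tens[OF Cb_dom_scale[OF f] g f' g'] inner_tens[OF f g f' g'] by simp
qed

lemma tens_add_right:
  assumes f: "f \<in> Cb_dom M cls D" and g: "g\<^sub>1 \<in> bounded_borel" "g\<^sub>2 \<in> bounded_borel"
  shows "tens f (\<lambda>x. g\<^sub>1 x + g\<^sub>2 x) = tens f g\<^sub>1 + tens f g\<^sub>2"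
proof (rule tens_eqI)
  fix f' g' :: "'x \<Rightarrow> real" assume f': "f' \<in> Cb_dom M cls D" and g': "g' \<in> bounded_borel"
  have D: "cls f \<in> D" "cls f' \<in> D" using f f' by (auto simp: Cb_dom_def)
  show "inner (tens f (\<lambda>x. g\<^sub>1 x + g\<^sub>2 x)) (tens f' g') = inner (tens f g\<^sub>1 + tens f g\<^sub>2) (tens f' g')"
    using inner_tens[OF f bounded_borel_add[OF g] f' g'] inner_tens[OF f g(1) f' g']
      inner_tens[OF f g(2) f' g'] tens_integrable[OF g(1) g' D] tens_integrable[OF g(2) g' D]
    by (simp add: inner_add_left distrib_right)
qed

lemma tens_scale_right:
  assumes f: "f \<in> Cb_dom M cls D" and g: "g \<in> bounded_borel"
  shows "tens f (\<lambda>x. a * g x) = a *\<^sub>R tens f g"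
proof (rule tens_eqI)
  fix f' g' :: "'x \<Rightarrow> real" assume f': "f' \<in> Cb_dom M cls D" and g': "g' \<in> bounded_borel"
  show "inner (tens f (\<lambda>x. a * g x)) (tens f' g') = inner (a *\<^sub>R tens f g) (tens f' g')"
    using inner_tens[OF f bounded_borel_scale[OF g] f' g'] inner_tens[OF f g f' g']
    by (simp add: mult.assoc)
qed

end

end

theory Submission imports Defs begin

text \<open>
  Let \<open>d\<close> be the exterior derivative.  Closedness and regularity of the form make \<open>d\<close> a closed,
  densely defined operator with domain \<open>Dom E\<close> and \<open>\<langle>d u, d v\<rangle> = E(u, v)\<close>
  (\<open>Domain_ext_deriv\<close>, \<open>inner_ext_deriv\<close>).  Hence the generator of the form is \<open>- d\<^sup>* d\<close>
  (\<open>laplacian_eq_form_laplacian\<close>), while the Laplacian on one-forms is \<open>- d d\<^sup>*\<close> by definition.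

  The rest is operator theory on Hilbert spaces.  Projecting onto the graph of \<open>d\<close> shows that
  \<open>1 + l d\<^sup>* d\<close> is onto for \<open>l > 0\<close>, and, with \<open>d\<^sup>*\<close> in place of \<open>d\<close>, the same holds for
  \<open>1 + l d d\<^sup>*\<close>; so both Laplacians are maximally dissipative.  If \<open>u + l d\<^sup>* d u = f\<close> with \<open>f\<close> in the
  domain of \<open>d\<close>, then applying \<open>d\<close> gives \<open>d u + l d d\<^sup>* (d u) = d f\<close>: the operator \<open>d\<close> intertwines the
  resolvents.

  A maximally dissipative operator \<open>A\<close> generates exactly one strongly continuous semigroup, the
  limit of the implicit Euler scheme \<open>(1 - A / 2\<^sup>k)\<^sup>-\<^sup>n\<close> with \<open>n = \<lfloor>2\<^sup>k t\<rfloor>\<close>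
  (\<open>euler_tendsto\<close>, \<open>generator_sgrp\<close>, \<open>semigroup_eq_sgrp\<close>).  The scheme converges on the domain of
  \<open>A\<^sup>2\<close> because halving the step changes the result only in second order, and everywhere by
  contractivity.  Since it consists of powers of resolvents, \<open>d\<close> intertwines the two schemes, and as
  \<open>d\<close> is closed, also their limits (\<open>op_exp_intertwine\<close>).
\<close>

section \<open>Cauchy sequences and orthogonal projections\<close>

lemma Cauchy_if_square_dist_le:
  fixes s :: "nat \<Rightarrow> 'a::metric_space"
  assumes close: "\<And>i j. (dist (s i) (s j))\<^sup>2 \<le> 2 / Suc i + 2 / Suc j"
  shows "Cauchy s"
proof (rule metric_CauchyI)
  fix e :: real assume e: "e > 0"
  obtain N :: nat where N: "4 / e\<^sup>2 < N" using reals_Archimedean2 by blast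
  have "dist (s i) (s j) < e" if "i \<ge> N" "j \<ge> N" for i j
  proof -
    have pos: "0 < 4 / e\<^sup>2" using e by simp
    then have N0: "0 < real N" using N by linarith
    have "2 / Suc i \<le> 2 / N" "2 / Suc j \<le> 2 / N"
      using that N0 by (simp_all add: frac_le)
    then have "(dist (s i) (s j))\<^sup>2 \<le> 4 / N"
      using close[of i j] by simp
    also have "4 / N < e\<^sup>2"
      using N N0 e by (simp add: field_simps)
    finally show ?thesis
      using e by (simp add: power_less_imp_less_base)
  qed
  then show "\<exists>N. \<forall>i\<ge>N. \<forall>j\<ge>N. dist (s i) (s j) < e" by blast
qed

lemma Cauchy_if_geometric_steps:
  fixes s :: "nat \<Rightarrow> 'a::real_normed_vector"
  assumes step: "\<And>k. norm (s (Suc k) - s k) \<le> C * (1/2) ^ k"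
  shows "Cauchy s"
proof -
  define S where "S n = (\<Sum>k<n. C * (1/2::real) ^ k)" for n
  have le: "norm (s n - s m) \<le> S n - S m" if "m \<le> n" for m n
    using that
  proof (induction n rule: dec_induct)
    case (step n)
    have "norm (s (Suc n) - s m) \<le> norm (s (Suc n) - s n) + norm (s n - s m)"
      using norm_triangle_ineq[of "s (Suc n) - s n" "s n - s m"] by simp
    also have "\<dots> \<le> C * (1/2) ^ n + (S n - S m)"
      by (rule add_mono[OF assms step.IH])
    also have "\<dots> = S (Suc n) - S m" by (simp add: S_def)
    finally show ?case .
  qed simp
  have "summable (\<lambda>k. C * (1/2::real) ^ k)" by (intro summable_mult summable_geometric) simp
  then have "Cauchy S"
    unfolding S_def by (intro LIMSEQ_imp_Cauchy[OF summable_LIMSEQ])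
  show ?thesis
  proof (rule metric_CauchyI)
    fix e :: real assume "e > 0"
    then obtain N where N: "\<forall>m\<ge>N. \<forall>n\<ge>N. dist (S m) (S n) < e"
      using metric_CauchyD[OF \<open>Cauchy S\<close>] by blast
    have "dist (s m) (s n) < e" if "m \<ge> N" "n \<ge> N" for m n
    proof (cases "m \<le> n")
      case True
      have "dist (s m) (s n) = norm (s n - s m)" by (simp add: dist_norm norm_minus_commute)
      also have "\<dots> \<le> dist (S m) (S n)" using le[OF True] by (simp add: dist_real_def)
      finally show ?thesis using N that by fastforce
    next
      case False
      have "dist (s m) (s n) = norm (s m - s n)" by (simp add: dist_norm)
      also have "\<dots> \<le> dist (S m) (S n)" using le[of n m] False by (simp add: dist_real_def)
      finally show ?thesis using N that by fastforce
    qed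
    then show "\<exists>N. \<forall>m\<ge>N. \<forall>n\<ge>N. dist (s m) (s n) < e" by blast
  qed
qed

lemma closed_subspace_orthogonal_projection:
  fixes S :: "'a::{real_inner, complete_space} set"
  assumes "closed S" "subspace S"
  obtains p where "p \<in> S" "\<And>s. s \<in> S \<Longrightarrow> inner (x - p) s = 0"
proof -
  define m where "m = Inf ((\<lambda>s. (norm (x - s))\<^sup>2) ` S)"
  have bdd: "bdd_below ((\<lambda>s. (norm (x - s))\<^sup>2) ` S)"
    by (rule bdd_belowI[of _ 0]) auto
  have S0: "0 \<in> S" using subspace_0[OF assms(2)] .
  have m_le: "m \<le> (norm (x - s))\<^sup>2" if "s \<in> S" for s
    unfolding m_def using that bdd by (intro cInf_lower) auto
  have "\<exists>s\<in>S. (norm (x - s))\<^sup>2 < m + 1 / Suc n" for n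
  proof -
    have "\<exists>y\<in>(\<lambda>s. (norm (x - s))\<^sup>2) ` S. y < m + 1 / Suc n"
      using S0 unfolding m_def by (intro cInf_lessD) auto
    then show ?thesis by auto
  qed
  then obtain s where s: "\<And>n. s n \<in> S" "\<And>n. (norm (x - s n))\<^sup>2 < m + 1 / Suc n" by metis
  have close: "(norm (s i - s j))\<^sup>2 \<le> 2 / Suc i + 2 / Suc j" for i j
  proof -
    have "(1/2) *\<^sub>R (s i + s j) \<in> S"
      by (intro subspace_scale subspace_add assms s)
    then have "m \<le> (norm (x - (1/2) *\<^sub>R (s i + s j)))\<^sup>2" by (rule m_le)
    moreover have "(norm (s i - s j))\<^sup>2 = 2 * (norm (x - s i))\<^sup>2 + 2 * (norm (x - s j))\<^sup>2
        - 4 * (norm (x - (1/2) *\<^sub>R (s i + s j)))\<^sup>2"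
      unfolding power2_norm_eq_inner
      by (simp add: inner_diff_left inner_diff_right inner_add_left inner_add_right inner_commute algebra_simps)
    ultimately show ?thesis using s(2)[of i] s(2)[of j] by simp
  qed
  then have "Cauchy s" by (intro Cauchy_if_square_dist_le) (simp add: dist_norm)
  then obtain p where p: "s \<longlonglongrightarrow> p" using Cauchy_convergent_iff convergent_def by blast
  have pS: "p \<in> S" using closed_sequentially[OF assms(1) _ p] s(1) by blast
  have "(norm (x - p))\<^sup>2 \<le> m + 0"
  proof (rule LIMSEQ_le)
    show "(\<lambda>n. (norm (x - s n))\<^sup>2) \<longlonglongrightarrow> (norm (x - p))\<^sup>2"
      by (intro tendsto_intros p)
    show "(\<lambda>n. m + 1 / Suc n) \<longlonglongrightarrow> m + 0"
      by (intro tendsto_add tendsto_const) (rule LIMSEQ_inverse_real_of_nat[unfolded inverse_eq_divide])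
    show "\<exists>N. \<forall>n\<ge>N. (norm (x - s n))\<^sup>2 \<le> m + 1 / Suc n"
      using s(2) less_imp_le by blast
  qed
  then have min: "(norm (x - p))\<^sup>2 \<le> (norm (x - v))\<^sup>2" if "v \<in> S" for v
    using m_le[OF that] by linarith
  show thesis
  proof (rule that[OF pS])
    fix v assume v: "v \<in> S"
    show "inner (x - p) v = 0"
    proof (rule ccontr)
      assume ne: "inner (x - p) v \<noteq> 0"
      then have v0: "inner v v > 0" by auto
      define c where "c = inner (x - p) v / inner v v"
      have "p + c *\<^sub>R v \<in> S" by (intro subspace_add subspace_scale assms pS v)
      then have "(norm (x - p))\<^sup>2 \<le> (norm ((x - p) - c *\<^sub>R v))\<^sup>2"
        using min by (simp add: diff_diff_eq)
      also have "\<dots> = (norm (x - p))\<^sup>2 - 2 * c * inner (x - p) v + c * c * inner v v"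
        unfolding power2_norm_eq_inner inner_diff_left[of "x - p"] inner_diff_right[of _ "x - p"]
        by (simp add: inner_commute)
      also have "c * c * inner v v = c * inner (x - p) v"
        using v0 by (simp add: c_def)
      finally have "c * inner (x - p) v \<le> 0" by simp
      moreover have "c * inner (x - p) v > 0"
      proof -
        have "0 < inner (x - p) v * inner (x - p) v"
          using ne not_real_square_gt_zero by blast
        then have "0 < inner (x - p) v * inner (x - p) v / inner v v"
          using v0 by (rule divide_pos_pos)
        then show ?thesis by (simp only: c_def times_divide_eq_left)
      qed
      ultimately show False by simp
    qed
  qed
qed

lemma subspace_closure:
  fixes S :: "'a::real_normed_vector set"
  assumes "subspace S"
  shows "subspace (closure S)"
proof (rule subspaceI)
  show "0 \<in> closure S" using subspace_0[OF assms] closure_subset by blast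
next
  fix x y assume x: "x \<in> closure S" and y: "y \<in> closure S"
  obtain u where u: "\<forall>n. u n \<in> S" "u \<longlonglongrightarrow> x"
    using x unfolding closure_sequential by (elim exE conjE)
  obtain v where v: "\<forall>n. v n \<in> S" "v \<longlonglongrightarrow> y"
    using y unfolding closure_sequential by (elim exE conjE)
  show "x + y \<in> closure S"
    unfolding closure_sequential using u v subspace_add[OF assms]
    by (intro exI[of _ "\<lambda>n. u n + v n"]) (simp add: tendsto_add)
next
  fix c x assume x: "x \<in> closure S"
  obtain u where u: "\<forall>n. u n \<in> S" "u \<longlonglongrightarrow> x"
    using x unfolding closure_sequential by (elim exE conjE)
  show "c *\<^sub>R x \<in> closure S"
    unfolding closure_sequential using u subspace_scale[OF assms]
    by (intro exI[of _ "\<lambda>n. c *\<^sub>R u n"]) (simp add: tendsto_intros)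
qed

lemma closure_subspace_eq_UNIV_if_trivial_complement:
  fixes S :: "'a::{real_inner, complete_space} set"
  assumes S: "subspace S"
    and orth: "\<And>z. (\<And>s. s \<in> S \<Longrightarrow> inner z s = 0) \<Longrightarrow> z = 0"
  shows "closure S = UNIV"
proof -
  have "x \<in> closure S" for x
  proof -
    obtain p where p: "p \<in> closure S" "\<And>s. s \<in> closure S \<Longrightarrow> inner (x - p) s = 0"
      using closed_subspace_orthogonal_projection[where x = x, OF closed_closure subspace_closure[OF S]]
      by blast
    then have "x - p = 0" using closure_subset by (intro orth) blast
    then show ?thesis using p(1) by simp
  qed
  then show ?thesis by blast
qed

lemma inner_eq_zero_if_dense:
  fixes z :: "'a::real_inner"
  assumes "closure S = UNIV" "\<And>s. s \<in> S \<Longrightarrow> inner z s = 0"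
  shows "z = 0"
proof -
  have "closed {s. inner z s = 0}" by (intro closed_Collect_eq continuous_intros)
  then have "closure S \<subseteq> {s. inner z s = 0}" using assms(2) by (intro closure_minimal) auto
  then have "inner z z = 0" using assms(1) by blast
  then show ?thesis by simp
qed

section \<open>Resolvents of maximally dissipative operators\<close>

text \<open>
  The graph of a linear, single-valued, maximally dissipative operator \<open>A\<close> on a Hilbert space:
  \<open>\<langle>x, A x\<rangle> \<le> 0\<close> and \<open>1 - l A\<close> is onto for every \<open>l > 0\<close>.  Density of the domain is a consequence.
\<close>

locale m_dissipative =
  fixes A :: "('a::{real_inner, complete_space} \<times> 'a) set"
  assumes subspace_graph: "subspace A"
    and single_valued_0: "(0, y) \<in> A \<Longrightarrow> y = 0"
    and dissipative: "(x, y) \<in> A \<Longrightarrow> inner x y \<le> 0"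
    and resolvent_onto: "l > 0 \<Longrightarrow> \<exists>x y. (x, y) \<in> A \<and> x - l *\<^sub>R y = f"
begin

text \<open>
  The resolvent \<open>J l = (1 - l A)\<inverse>\<close>, meaningful for \<open>l > 0\<close>; the choice is unique by dissipativity.
\<close>

definition J :: "real \<Rightarrow> 'a \<Rightarrow> 'a" where
  "J l f = (SOME x. \<exists>y. (x, y) \<in> A \<and> x - l *\<^sub>R y = f)"

lemma graph_add: "(x, y) \<in> A \<Longrightarrow> (x', y') \<in> A \<Longrightarrow> (x + x', y + y') \<in> A"
  using subspace_add[OF subspace_graph, of "(x, y)" "(x', y')"] by simp

lemma graph_diff: "(x, y) \<in> A \<Longrightarrow> (x', y') \<in> A \<Longrightarrow> (x - x', y - y') \<in> A"
  using subspace_diff[OF subspace_graph, of "(x, y)" "(x', y')"] by simp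

lemma graph_scale: "(x, y) \<in> A \<Longrightarrow> (c *\<^sub>R x, c *\<^sub>R y) \<in> A"
  using subspace_scale[OF subspace_graph, of "(x, y)" c] by simp

lemma norm_le_resolvent:
  assumes "(x, y) \<in> A" "l > 0"
  shows "norm x \<le> norm (x - l *\<^sub>R y)"
proof -
  have "(norm (x - l *\<^sub>R y))\<^sup>2 = (norm x)\<^sup>2 - 2 * l * inner x y + (norm (l *\<^sub>R y))\<^sup>2"
    unfolding power2_norm_eq_inner by (simp add: inner_diff_left inner_diff_right inner_commute)
  moreover have "l * inner x y \<le> 0"
    using dissipative[OF assms(1)] assms(2) by (simp add: mult_nonneg_nonpos)
  ultimately have "(norm x)\<^sup>2 \<le> (norm (x - l *\<^sub>R y))\<^sup>2"
    using zero_le_power2[of "norm (l *\<^sub>R y)"] by linarith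
  then show ?thesis
    by (rule power2_le_imp_le) simp
qed

lemma J_eqI:
  assumes "(x, y) \<in> A" "x - l *\<^sub>R y = f" "l > 0"
  shows "J l f = x"
  unfolding J_def
proof (rule some_equality)
  fix x' assume "\<exists>y. (x', y) \<in> A \<and> x' - l *\<^sub>R y = f"
  then obtain y' where y': "(x', y') \<in> A" "x' - l *\<^sub>R y' = f" by auto
  have "norm (x' - x) \<le> norm ((x' - x) - l *\<^sub>R (y' - y))"
    using norm_le_resolvent[OF graph_diff[OF y'(1) assms(1)] assms(3)] .
  also have "(x' - x) - l *\<^sub>R (y' - y) = 0"
    using y'(2) assms(2) by (simp add: algebra_simps)
  finally show "x' = x" by simp
qed (use assms in auto)

lemma J_obtain:
  assumes "l > 0"
  obtains y where "(J l f, y) \<in> A" "J l f - l *\<^sub>R y = f"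
proof -
  obtain x y where "(x, y) \<in> A" "x - l *\<^sub>R y = f"
    using resolvent_onto[OF assms] by blast
  then show thesis using that[of y] J_eqI[of x y l f] assms by simp
qed

lemma J_add: "l > 0 \<Longrightarrow> J l (f + g) = J l f + J l g"
proof -
  assume l: "l > 0"
  obtain y where y: "(J l f, y) \<in> A" "J l f - l *\<^sub>R y = f" using J_obtain[OF l] .
  obtain z where z: "(J l g, z) \<in> A" "J l g - l *\<^sub>R z = g" using J_obtain[OF l] .
  have "J l f + J l g - l *\<^sub>R (y + z) = (J l f - l *\<^sub>R y) + (J l g - l *\<^sub>R z)"
    by (simp add: algebra_simps)
  then have "J l f + J l g - l *\<^sub>R (y + z) = f + g"
    unfolding y(2) z(2) .
  then show ?thesis
    by (rule J_eqI[OF graph_add[OF y(1) z(1)] _ l])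
qed

lemma J_scale: "l > 0 \<Longrightarrow> J l (c *\<^sub>R f) = c *\<^sub>R J l f"
proof -
  assume l: "l > 0"
  obtain y where y: "(J l f, y) \<in> A" "J l f - l *\<^sub>R y = f" using J_obtain[OF l] .
  have "c *\<^sub>R J l f - l *\<^sub>R c *\<^sub>R y = c *\<^sub>R (J l f - l *\<^sub>R y)"
    by (simp add: algebra_simps)
  then have "c *\<^sub>R J l f - l *\<^sub>R c *\<^sub>R y = c *\<^sub>R f"
    unfolding y(2) .
  then show ?thesis
    by (rule J_eqI[OF graph_scale[OF y(1)] _ l])
qed

lemma linear_J: "l > 0 \<Longrightarrow> linear (J l)"
  by (intro linearI J_add J_scale)

lemma norm_J_le: "l > 0 \<Longrightarrow> norm (J l f) \<le> norm f"
proof -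
  assume l: "l > 0"
  obtain y where "(J l f, y) \<in> A" "J l f - l *\<^sub>R y = f" using J_obtain[OF l] .
  then show ?thesis using norm_le_resolvent[of "J l f" y l] l by simp
qed

lemma J_graph:
  assumes l: "l > 0" and A: "(x, y) \<in> A"
  shows "(J l x, J l y) \<in> A" and "J l x - x = l *\<^sub>R J l y"
proof -
  have "J l (x - l *\<^sub>R y) = x" using J_eqI[OF A _ l] by simp
  then have *: "J l x - l *\<^sub>R J l y = x"
    using l by (simp add: linear_diff linear_J J_scale)
  then show "J l x - x = l *\<^sub>R J l y" by (simp add: algebra_simps)
  obtain v where v: "(J l x, v) \<in> A" "J l x - l *\<^sub>R v = x" using J_obtain[OF l] .
  have "l *\<^sub>R v = J l x - (J l x - l *\<^sub>R v)" by simp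
  also have "\<dots> = J l x - (J l x - l *\<^sub>R J l y)" unfolding v(2) * ..
  finally have "l *\<^sub>R v = l *\<^sub>R J l y" by simp
  then show "(J l x, J l y) \<in> A" using v l by simp
qed

lemma linear_J_power: "l > 0 \<Longrightarrow> linear (J l ^^ n)"
proof (induction n)
  case 0 then show ?case using linear_id by (simp add: id_def)
next
  case (Suc n) then show ?case using linear_compose[OF Suc.IH[OF Suc.prems] linear_J[OF Suc.prems]] by (simp add: o_def)
qed

lemma norm_J_power_le: "l > 0 \<Longrightarrow> norm ((J l ^^ n) f) \<le> norm f"
proof (induction n)
  case (Suc n)
  then show ?case using norm_J_le[OF Suc.prems, of "(J l ^^ n) f"] by simp
qed simp

lemma J_power_graph: "l > 0 \<Longrightarrow> (x, y) \<in> A \<Longrightarrow> ((J l ^^ n) x, (J l ^^ n) y) \<in> A"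
proof (induction n)
  case (Suc n)
  then show ?case using J_graph(1)[of l "(J l ^^ n) x" "(J l ^^ n) y"] by simp
qed simp

lemma norm_J_power_diff_le:
  assumes "l > 0" "(x, y) \<in> A"
  shows "norm ((J l ^^ n) x - x) \<le> n * l * norm y"
proof (induction n)
  case (Suc n)
  have "norm ((J l ^^ Suc n) x - (J l ^^ n) x) = l * norm (J l ((J l ^^ n) y))"
    using J_graph(2)[OF assms(1) J_power_graph[OF assms, of n]] assms(1) by simp
  also have "\<dots> \<le> l * norm y"
    using norm_J_power_le[OF assms(1), of "Suc n" y] assms(1) by (intro mult_left_mono) auto
  finally have 1: "norm ((J l ^^ Suc n) x - (J l ^^ n) x) \<le> l * norm y" .
  have "norm ((J l ^^ Suc n) x - x) \<le> norm ((J l ^^ Suc n) x - (J l ^^ n) x) + norm ((J l ^^ n) x - x)"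
    by (rule order_trans[OF _ norm_triangle_ineq]) simp
  also have "\<dots> \<le> l * norm y + n * l * norm y" by (rule add_mono[OF 1 Suc])
  finally show ?case by (simp add: algebra_simps)
qed simp

text \<open>
  A quantitative form of \<open>J\<^sup>n x = x + n l A x + o(n l)\<close>.  Since \<open>y = A x\<close> need not lie in the domain
  of \<open>A\<close>, it is compared with an arbitrary \<open>z\<close> of the domain, which can be taken close to \<open>y\<close>.
\<close>

lemma norm_J_power_expansion_le:
  assumes l: "l > 0" and xy: "(x, y) \<in> A" and zz: "(z, z') \<in> A" and n: "n \<le> N"
  shows "norm ((J l ^^ n) x - x - (n * l) *\<^sub>R y)
    \<le> n * l * (N * l * norm z' + 2 * norm (y - z))"
  using n
proof (induction n)
  case (Suc n)
  let ?P = "J l ^^ Suc n" and ?b = "N * l * norm z' + 2 * norm (y - z)"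
  have step: "?P x - (J l ^^ n) x = l *\<^sub>R ?P y"
    using J_graph(2)[OF l J_power_graph[OF l xy, of n]] by simp
  have "?P y - y = ?P (y - z) + (?P z - z) + (z - y)"
    by (simp only: linear_diff[OF linear_J_power[OF l]]) simp
  then have "norm (?P y - y) \<le> norm (?P (y - z)) + norm (?P z - z) + norm (z - y)"
    by (metis norm_triangle_ineq norm_triangle_mono order_refl)
  also have "norm (?P z - z) \<le> Suc n * l * norm z'"
    by (rule norm_J_power_diff_le[OF l zz])
  also have "Suc n * l * norm z' \<le> N * l * norm z'"
    using Suc.prems l by (intro mult_right_mono) auto
  also have "norm (?P (y - z)) \<le> norm (y - z)" by (rule norm_J_power_le[OF l])
  finally have 1: "norm (?P y - y) \<le> ?b" by (simp add: norm_minus_commute)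
  have "?P x - x - (Suc n * l) *\<^sub>R y
      = ((J l ^^ n) x - x - (n * l) *\<^sub>R y) + (?P x - (J l ^^ n) x - l *\<^sub>R y)"
    by (simp add: algebra_simps)
  also have "?P x - (J l ^^ n) x - l *\<^sub>R y = l *\<^sub>R (?P y - y)"
    unfolding step by (simp only: scaleR_diff_right)
  finally have "norm (?P x - x - (Suc n * l) *\<^sub>R y)
      \<le> norm ((J l ^^ n) x - x - (n * l) *\<^sub>R y) + norm (l *\<^sub>R (?P y - y))"
    by (simp only: norm_triangle_ineq)
  also have "norm (l *\<^sub>R (?P y - y)) \<le> l * ?b"
    using 1 l by simp
  also have "norm ((J l ^^ n) x - x - (n * l) *\<^sub>R y) \<le> n * l * ?b"
    using Suc by simp
  finally show ?case by (simp add: algebra_simps)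
qed simp

text \<open>
  Two implicit Euler steps of length \<open>l\<close> differ from one step of length \<open>2 l\<close> only in second order,
  because \<open>(1 - l A)\<^sup>2 - (1 - 2 l A) = l\<^sup>2 A\<^sup>2\<close>.
\<close>

lemma norm_J_halving_le:
  assumes l: "l > 0" and xy: "(x, y) \<in> A" and yz: "(y, z) \<in> A"
  shows "norm (J l (J l x) - J (2 * l) x) \<le> l\<^sup>2 * norm z"
proof -
  let ?S = "J (2 * l)" and ?Q = "\<lambda>x. J l (J l x)"
  have l2: "2 * l > 0" using l by simp
  have Jx: "J l x = x + l *\<^sub>R J l y" and Jy: "J l y = y + l *\<^sub>R J l z"
    using J_graph(2)[OF l xy] J_graph(2)[OF l yz] by (simp_all add: algebra_simps)
  have QA: "(?Q x, ?Q y) \<in> A" by (intro J_graph(1)[OF l] xy)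
  have Qx: "?Q x = J l x + l *\<^sub>R ?Q y"
    using J_graph(2)[OF l J_graph(1)[OF l xy]] by (simp add: algebra_simps)
  have Qy: "?Q y = J l y + l *\<^sub>R ?Q z"
    using J_graph(2)[OF l J_graph(1)[OF l yz]] by (simp add: algebra_simps)
  have "?Q x - (2 * l) *\<^sub>R ?Q y = J l x - l *\<^sub>R ?Q y"
    unfolding mult_2 scaleR_left_distrib by (subst Qx) simp
  also have "\<dots> = x - (l * l) *\<^sub>R ?Q z"
    by (subst Jx, subst Qy) (simp add: algebra_simps)
  finally have "?S (x - (l * l) *\<^sub>R ?Q z) = ?Q x"
    by (rule J_eqI[OF QA _ l2])
  then have "?Q x - ?S x = - ((l * l) *\<^sub>R ?S (?Q z))"
    by (simp add: linear_diff[OF linear_J[OF l2]] J_scale[OF l2] flip: \<open>_ = ?Q x\<close>)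
  then have "norm (?Q x - ?S x) = l\<^sup>2 * norm (?S (?Q z))"
    by (simp only: norm_minus_cancel norm_scaleR) (simp add: power2_eq_square)
  also have "norm (?S (?Q z)) \<le> norm z"
    by (rule order_trans[OF norm_J_le[OF l2] order_trans[OF norm_J_le[OF l] norm_J_le[OF l]]])
  finally show ?thesis by (simp add: mult_left_mono)
qed

lemma norm_J_power_halving_le:
  assumes l: "l > 0" and xy: "(x, y) \<in> A" and yz: "(y, z) \<in> A"
  shows "norm ((J l ^^ (2 * n)) x - (J (2 * l) ^^ n) x) \<le> n * l\<^sup>2 * norm z"
proof (induction n)
  case (Suc n)
  have l2: "2 * l > 0" using l by simp
  let ?Q = "\<lambda>x. J l (J l x)" and ?u = "(J (2 * l) ^^ n) x"
  have "(J l ^^ (2 * Suc n)) x - (J (2 * l) ^^ Suc n) x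
      = ?Q ((J l ^^ (2 * n)) x - ?u) + (?Q ?u - J (2 * l) ?u)"
    by (simp add: linear_diff[OF linear_J[OF l]])
  then have "norm ((J l ^^ (2 * Suc n)) x - (J (2 * l) ^^ Suc n) x)
      \<le> norm (?Q ((J l ^^ (2 * n)) x - ?u)) + norm (?Q ?u - J (2 * l) ?u)"
    by (simp only: norm_triangle_ineq)
  also have "norm (?Q ((J l ^^ (2 * n)) x - ?u)) \<le> norm ((J l ^^ (2 * n)) x - ?u)"
    by (rule order_trans[OF norm_J_le[OF l] norm_J_le[OF l]])
  also have "\<dots> \<le> n * l\<^sup>2 * norm z" by (rule Suc)
  also have "norm (?Q ?u - J (2 * l) ?u) \<le> l\<^sup>2 * norm ((J (2 * l) ^^ n) z)"
    by (rule norm_J_halving_le[OF l J_power_graph[OF l2 xy] J_power_graph[OF l2 yz]])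
  also have "\<dots> \<le> l\<^sup>2 * norm z"
    by (intro mult_left_mono norm_J_power_le[OF l2]) simp
  finally show ?case by (simp add: algebra_simps)
qed simp

end

section \<open>The semigroup generated by a maximally dissipative operator\<close>

context m_dissipative
begin

lemma subspace_Domain: "subspace (Domain A)"
proof (rule subspaceI)
  show "0 \<in> Domain A"
    using subspace_0[OF subspace_graph] by (auto simp: zero_prod_def)
qed (auto intro: graph_add graph_scale)

lemma dense_Domain: "closure (Domain A) = UNIV"
proof (rule closure_subspace_eq_UNIV_if_trivial_complement[OF subspace_Domain])
  fix z assume z: "\<And>s. s \<in> Domain A \<Longrightarrow> inner z s = 0"
  have l: "(1::real) > 0" by simp
  obtain y where y: "(J 1 z, y) \<in> A" "J 1 z - 1 *\<^sub>R y = z" using J_obtain[OF l] .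
  have "inner z (J 1 z) = inner (J 1 z) (J 1 z) - inner (J 1 z) y"
    by (subst y(2)[symmetric]) (simp add: inner_diff_left inner_diff_right inner_commute)
  moreover have "inner z (J 1 z) = 0" using z y(1) by blast
  ultimately have "inner (J 1 z) (J 1 z) \<le> 0"
    using dissipative[OF y(1)] by linarith
  then have J0: "J 1 z = 0" by (metis inner_gt_zero_iff not_le)
  then have "y = 0" using y(1) single_valued_0 by simp
  then show "z = 0" using y(2) J0 by simp
qed

lemma J_tendsto: "((\<lambda>l. J l f) \<longlongrightarrow> f) (at_right 0)"
proof (rule tendstoI)
  fix e :: real assume e: "e > 0"
  obtain x y where xy: "(x, y) \<in> A" "dist x f < e / 3"
    using dense_Domain e closure_approachable[of f "Domain A"] by (auto dest!: spec[of _ "e / 3"])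
  have "((\<lambda>l. l * norm y) \<longlongrightarrow> 0 * norm y) (at_right 0)" by (intro tendsto_intros)
  then have "\<forall>\<^sub>F l in at_right 0. l * norm y < e / 3"
    using e by (intro order_tendstoD) auto
  moreover have "\<forall>\<^sub>F l::real in at_right 0. l > 0" by (simp add: eventually_at_right_less)
  ultimately show "\<forall>\<^sub>F l in at_right 0. dist (J l f) f < e"
  proof eventually_elim
    case (elim l)
    have "norm (J l x - x) = l * norm (J l y)"
      using J_graph(2)[OF elim(2) xy(1)] elim(2) by simp
    also have "\<dots> \<le> l * norm y" using norm_J_le[OF elim(2)] elim(2) by simp
    finally have 1: "norm (J l x - x) < e / 3" using elim(1) by simp
    have 2: "norm (J l f - J l x) < e / 3"
      using norm_J_le[OF elim(2), of "f - x"] xy(2)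
      by (simp add: linear_diff[OF linear_J[OF elim(2)]] dist_norm norm_minus_commute)
    have "norm (J l f - f) \<le> norm (J l f - J l x) + norm (J l x - x) + norm (x - f)"
      using norm_triangle_ineq[of "J l f - J l x" "J l x - x"]
        norm_triangle_ineq[of "J l f - x" "x - f"] by simp
    then show ?case using 1 2 xy(2) by (simp add: dist_norm)
  qed
qed

lemma dense_square_domain:
  assumes "e > 0"
  obtains x y z where "(x, y) \<in> A" "(y, z) \<in> A" "norm (f - x) < e"
proof -
  have "\<forall>\<^sub>F l in at_right 0. dist (J l f) f < e / 2"
    using tendstoD[OF J_tendsto, of "e / 2" f] assms by simp
  then have "\<forall>\<^sub>F l in at_right 0. dist (J l f) f < e / 2 \<and> l > 0"
    using eventually_at_right_less by (rule eventually_conj)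
  then obtain l where l: "dist (J l f) f < e / 2" "l > 0"
    using eventually_happens'[OF trivial_limit_at_right_real] by blast
  obtain v where v: "(J l f, v) \<in> A" using J_obtain[OF l(2)] .
  obtain w where w: "(J l v, w) \<in> A" using J_obtain[OF l(2)] .
  have "norm (J l f - J l (J l f)) \<le> norm (f - J l f)"
    using norm_J_le[OF l(2), of "f - J l f"] by (simp add: linear_diff[OF linear_J[OF l(2)]])
  moreover have "norm (f - J l (J l f)) \<le> norm (f - J l f) + norm (J l f - J l (J l f))"
    using norm_triangle_ineq[of "f - J l f" "J l f - J l (J l f)"] by simp
  ultimately have "norm (f - J l (J l f)) < e"
    using l(1) by (simp add: dist_norm norm_minus_commute)
  with that[OF J_graph(1)[OF l(2) v] w] show thesis .
qed

text \<open>
  The implicit Euler approximation of \<open>e\<^sup>t\<^sup>A\<close> with step \<open>1 / 2\<^sup>k\<close>; the part of \<open>t\<close> beyond the last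
  full step is dropped.
\<close>

definition euler :: "nat \<Rightarrow> real \<Rightarrow> 'a \<Rightarrow> 'a" where
  "euler k t = J (1 / 2 ^ k) ^^ nat \<lfloor>2 ^ k * t\<rfloor>"

text \<open>
  The semigroup \<open>e\<^sup>t\<^sup>A\<close> as the limit of the Euler approximations; meaningful for \<open>t \<ge> 0\<close>, where the
  limit exists.
\<close>

definition sgrp :: "real \<Rightarrow> 'a \<Rightarrow> 'a" where
  "sgrp t x = lim (\<lambda>k. euler k t x)"

lemma linear_euler: "linear (euler k t)"
  unfolding euler_def by (intro linear_J_power) simp

lemma norm_euler_le: "norm (euler k t x) \<le> norm x"
  unfolding euler_def by (intro norm_J_power_le) simp

lemma norm_euler_step_le:
  assumes t: "t \<ge> 0" and xy: "(x, y) \<in> A" and yz: "(y, z) \<in> A"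
  shows "norm (euler (Suc k) t x - euler k t x) \<le> (t * norm z + norm y) * (1/2) ^ k"
proof -
  define l :: real where "l = 1 / 2 ^ Suc k"
  define n where "n = nat \<lfloor>2 ^ k * t\<rfloor>"
  define e where "e = nat \<lfloor>2 ^ Suc k * t\<rfloor> - 2 * n"
  have l: "l > 0" by (simp add: l_def)
  have l2: "2 * l = 1 / 2 ^ k" by (simp add: l_def)
  have fl: "0 \<le> \<lfloor>2 ^ k * t\<rfloor>" using t by simp
  \<comment> \<open>Halving the step at most doubles the number of steps, up to one additional step.\<close>
  have "2 * \<lfloor>2 ^ k * t\<rfloor> \<le> \<lfloor>2 ^ Suc k * t\<rfloor>" "\<lfloor>2 ^ Suc k * t\<rfloor> \<le> 2 * \<lfloor>2 ^ k * t\<rfloor> + 1"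
    by (simp_all add: mult.assoc) linarith+
  then have e: "nat \<lfloor>2 ^ Suc k * t\<rfloor> = e + 2 * n" "e \<le> 1"
    using fl unfolding e_def n_def by linarith+
  have n: "n \<le> 2 ^ k * t" unfolding n_def using t by simp
  let ?u = "(J l ^^ (2 * n)) x"
  have "euler (Suc k) t x = (J l ^^ e) ?u"
    unfolding euler_def e(1) l_def[symmetric] by (simp add: funpow_add)
  moreover have "euler k t x = (J (2 * l) ^^ n) x"
    unfolding euler_def n_def l2 ..
  ultimately have "norm (euler (Suc k) t x - euler k t x)
      \<le> norm ((J l ^^ e) ?u - ?u) + norm (?u - (J (2 * l) ^^ n) x)"
    using norm_triangle_ineq[of "(J l ^^ e) ?u - ?u" "?u - (J (2 * l) ^^ n) x"] by simp
  also have "norm ((J l ^^ e) ?u - ?u) \<le> e * l * norm ((J l ^^ (2 * n)) y)"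
    by (rule norm_J_power_diff_le[OF l J_power_graph[OF l xy]])
  also have "\<dots> \<le> e * l * norm y"
    using l by (intro mult_left_mono norm_J_power_le) auto
  also have "\<dots> \<le> 1 * (2 * l) * norm y"
    using e(2) l by (intro mult_right_mono mult_mono) auto
  also have "norm (?u - (J (2 * l) ^^ n) x) \<le> n * l\<^sup>2 * norm z"
    by (rule norm_J_power_halving_le[OF l xy yz])
  also have "\<dots> \<le> (t * (2 * l)) * norm z"
  proof (rule mult_right_mono)
    have "n * l\<^sup>2 \<le> (2 ^ k * t) * l\<^sup>2" using n by (intro mult_right_mono) auto
    also have "\<dots> = t * (2 ^ k * l) * l" by (simp add: power2_eq_square)
    also have "2 ^ k * l = 1 / 2" by (simp add: l_def)
    also have "t * (1 / 2) * l \<le> t * (2 * l)" using t l by (simp add: mult_nonneg_nonneg)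
    finally show "n * l\<^sup>2 \<le> t * (2 * l)" .
  qed simp
  finally show ?thesis
    unfolding l2 by (simp add: power_one_over add_divide_distrib distrib_right)
qed

lemma euler_tendsto:
  assumes t: "t \<ge> 0"
  shows "(\<lambda>k. euler k t x) \<longlonglongrightarrow> sgrp t x"
proof -
  have "Cauchy (\<lambda>k. euler k t x)"
  proof (rule metric_CauchyI)
    fix e :: real assume e: "e > 0"
    \<comment> \<open>The step estimate needs \<open>u\<close> in the domain of \<open>A\<^sup>2\<close>; contractivity carries it over to \<open>x\<close>.\<close>
    then obtain u v w where u: "(u, v) \<in> A" "(v, w) \<in> A" "norm (x - u) < e / 3"
      using dense_square_domain[of "e / 3" x] by auto
    have "Cauchy (\<lambda>k. euler k t u)"
      by (rule Cauchy_if_geometric_steps, rule norm_euler_step_le[OF t u(1,2)])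
    then obtain N where N: "\<And>i j. i \<ge> N \<Longrightarrow> j \<ge> N \<Longrightarrow> dist (euler i t u) (euler j t u) < e / 3"
      using metric_CauchyD[of _ "e / 3"] e by (metis zero_less_divide_iff zero_less_numeral)
    have d: "dist (euler i t x) (euler i t u) < e / 3" for i
      using norm_euler_le[of i t "x - u"] u(3)
      by (simp add: dist_norm linear_diff[OF linear_euler])
    have "dist (euler i t x) (euler j t x) < e" if "i \<ge> N" "j \<ge> N" for i j
      using N[OF that] d[of i] d[of j]
        dist_triangle[of "euler i t x" "euler j t x" "euler i t u"]
        dist_triangle[of "euler i t u" "euler j t x" "euler j t u"]
        dist_commute[of "euler j t x" "euler j t u"] by linarith
    then show "\<exists>N. \<forall>i\<ge>N. \<forall>j\<ge>N. dist (euler i t x) (euler j t x) < e" by blast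
  qed
  then show ?thesis
    unfolding sgrp_def by (simp add: Cauchy_convergent_iff convergent_LIMSEQ_iff)
qed

lemma norm_sgrp_le: "t \<ge> 0 \<Longrightarrow> norm (sgrp t x) \<le> norm x"
  by (rule LIMSEQ_le_const2[OF tendsto_norm[OF euler_tendsto]]) (auto simp: norm_euler_le)

lemma linear_sgrp:
  assumes "t \<ge> 0" shows "linear (sgrp t)"
proof (rule linearI)
  fix x y
  have "(\<lambda>k. euler k t (x + y)) \<longlonglongrightarrow> sgrp t x + sgrp t y"
    unfolding linear_add[OF linear_euler] by (intro tendsto_add euler_tendsto assms)
  then show "sgrp t (x + y) = sgrp t x + sgrp t y"
    using euler_tendsto[OF assms] LIMSEQ_unique by blast
next
  fix c x
  have "(\<lambda>k. euler k t (c *\<^sub>R x)) \<longlonglongrightarrow> c *\<^sub>R sgrp t x"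
    unfolding linear_scale[OF linear_euler] by (intro tendsto_intros euler_tendsto assms)
  then show "sgrp t (c *\<^sub>R x) = c *\<^sub>R sgrp t x"
    using euler_tendsto[OF assms] LIMSEQ_unique by blast
qed

lemma bounded_linear_sgrp: "t \<ge> 0 \<Longrightarrow> bounded_linear (sgrp t)"
  using linear_sgrp norm_sgrp_le
  by (intro bounded_linear_intro[of _ 1]) (auto simp: linear_add linear_scale)

lemma sgrp_0: "sgrp 0 x = x"
  using euler_tendsto[of 0 x] by (simp add: euler_def LIMSEQ_const_iff)

lemma bounded_linear_eqI_Domain:
  fixes S T :: "'a \<Rightarrow> 'b::real_normed_vector"
  assumes "bounded_linear S" "bounded_linear T" "\<And>x y. (x, y) \<in> A \<Longrightarrow> S x = T x"
  shows "S x = T x"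
proof -
  have "closed {x. S x = T x}"
    by (intro closed_Collect_eq bounded_linear.continuous_on[OF assms(1)]
        bounded_linear.continuous_on[OF assms(2)] continuous_on_id)
  then have "closure (Domain A) \<subseteq> {x. S x = T x}"
    using assms(3) by (intro closure_minimal) auto
  then show ?thesis using dense_Domain by blast
qed

lemma sgrp_add:
  assumes s: "s \<ge> 0" and t: "t \<ge> 0"
  shows "sgrp (s + t) x = sgrp s (sgrp t x)"
proof -
  have lin: "bounded_linear (\<lambda>x. sgrp s (sgrp t x))"
    by (rule bounded_linear_compose[OF bounded_linear_sgrp[OF s] bounded_linear_sgrp[OF t]])
  have "sgrp (s + t) x = sgrp s (sgrp t x)" if xy: "(x, y) \<in> A" for x y
  proof -
    have comp: "(\<lambda>k. euler k s (euler k t x)) \<longlonglongrightarrow> sgrp s (sgrp t x)"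
    proof -
      have "(\<lambda>k. euler k s (euler k t x - sgrp t x)) \<longlonglongrightarrow> 0"
      proof (rule Lim_null_comparison)
        show "(\<lambda>k. norm (euler k t x - sgrp t x)) \<longlonglongrightarrow> 0"
          using euler_tendsto[OF t] by (intro tendsto_norm_zero) (simp add: LIM_zero)
      qed (simp add: norm_euler_le)
      then have "(\<lambda>k. euler k s (euler k t x - sgrp t x) + euler k s (sgrp t x)) \<longlonglongrightarrow> 0 + sgrp s (sgrp t x)"
        by (intro tendsto_add euler_tendsto[OF s])
      then show ?thesis by (simp add: linear_diff[OF linear_euler])
    qed
    have "(\<lambda>k. euler k (s + t) x - euler k s (euler k t x)) \<longlonglongrightarrow> 0"
    proof (rule Lim_null_comparison)
      show "\<forall>\<^sub>F k in sequentially. norm (euler k (s + t) x - euler k s (euler k t x)) \<le> (1/2) ^ k * norm y"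
      proof (rule always_eventually, rule allI)
        fix k
        define l :: real where "l = 1 / 2 ^ k"
        have l: "l > 0" by (simp add: l_def)
        define m n where "m = nat \<lfloor>2 ^ k * s\<rfloor>" and "n = nat \<lfloor>2 ^ k * t\<rfloor>"
        define e where "e = nat \<lfloor>2 ^ k * (s + t)\<rfloor> - (m + n)"
        \<comment> \<open>Splitting the time interval loses at most one Euler step.\<close>
        have "0 \<le> \<lfloor>2 ^ k * s\<rfloor>" "0 \<le> \<lfloor>2 ^ k * t\<rfloor>" using s t by simp_all
        moreover have "\<lfloor>2 ^ k * s\<rfloor> + \<lfloor>2 ^ k * t\<rfloor> \<le> \<lfloor>2 ^ k * (s + t)\<rfloor>"
          "\<lfloor>2 ^ k * (s + t)\<rfloor> \<le> \<lfloor>2 ^ k * s\<rfloor> + \<lfloor>2 ^ k * t\<rfloor> + 1"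
          by (simp_all add: distrib_left) linarith+
        ultimately have e: "nat \<lfloor>2 ^ k * (s + t)\<rfloor> = e + (m + n)" "e \<le> 1"
          unfolding e_def m_def n_def by linarith+
        let ?u = "(J l ^^ (m + n)) x"
        have "euler k (s + t) x = (J l ^^ e) ?u" "euler k s (euler k t x) = ?u"
          unfolding euler_def e(1) l_def[symmetric] m_def[symmetric] n_def[symmetric]
          by (simp_all add: funpow_add)
        then have "norm (euler k (s + t) x - euler k s (euler k t x)) = norm ((J l ^^ e) ?u - ?u)"
          by simp
        also have "\<dots> \<le> e * l * norm ((J l ^^ (m + n)) y)"
          by (rule norm_J_power_diff_le[OF l J_power_graph[OF l xy]])
        also have "\<dots> \<le> e * l * norm y"
          using l by (intro mult_left_mono norm_J_power_le) auto
        also have "\<dots> \<le> 1 * l * norm y"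
          using e(2) l by (intro mult_right_mono) auto
        finally show "norm (euler k (s + t) x - euler k s (euler k t x)) \<le> (1/2) ^ k * norm y"
          by (simp add: l_def power_one_over)
      qed
      show "(\<lambda>k. (1/2) ^ k * norm y) \<longlonglongrightarrow> 0"
        by (intro tendsto_mult_left_zero LIMSEQ_power_zero) simp
    qed
    from tendsto_add[OF this comp] have "(\<lambda>k. euler k (s + t) x) \<longlonglongrightarrow> sgrp s (sgrp t x)" by simp
    then show ?thesis using euler_tendsto[of "s + t" x] s t LIMSEQ_unique by auto
  qed
  then show ?thesis
    using bounded_linear_eqI_Domain[OF bounded_linear_sgrp lin, of "s + t" x] s t by simp
qed

lemma norm_sgrp_expansion_le:
  assumes h: "h \<ge> 0" and xy: "(x, y) \<in> A" and zz: "(z, z') \<in> A"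
  shows "norm (sgrp h x - x - h *\<^sub>R y) \<le> h * (h * norm z' + 2 * norm (y - z))"
proof (rule LIMSEQ_le_const2)
  \<comment> \<open>The time that is actually covered by the Euler steps.\<close>
  define r where "r k = real (nat \<lfloor>2 ^ k * h\<rfloor>) * (1 / 2 ^ k)" for k :: nat
  have r0: "0 \<le> r k" and r1: "r k \<le> h" and r2: "h - (1/2) ^ k \<le> r k" for k
  proof -
    have nn: "real (nat \<lfloor>2 ^ k * h\<rfloor>) = of_int \<lfloor>2 ^ k * h\<rfloor>" using h by simp
    have "of_int \<lfloor>2 ^ k * h\<rfloor> \<le> 2 ^ k * h" "2 ^ k * h - 1 \<le> of_int \<lfloor>2 ^ k * h\<rfloor>" by linarith+
    then show "0 \<le> r k" "r k \<le> h"
      unfolding r_def nn using h by (simp_all add: field_simps)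
    have "h - (1/2) ^ k = (2 ^ k * h - 1) * (1 / 2 ^ k)"
      by (simp add: field_simps power_one_over)
    also have "\<dots> \<le> r k"
      unfolding r_def nn by (intro mult_right_mono) (linarith, simp)
    finally show "h - (1/2) ^ k \<le> r k" .
  qed
  have "r \<longlonglongrightarrow> h"
  proof (rule real_tendsto_sandwich[of "\<lambda>k. h - (1/2) ^ k" r sequentially "\<lambda>_. h"])
    have "(\<lambda>k. h - (1/2) ^ k) \<longlonglongrightarrow> h - 0" by (intro tendsto_intros LIMSEQ_power_zero) simp
    then show "(\<lambda>k. h - (1/2) ^ k) \<longlonglongrightarrow> h" by simp
  qed (simp_all add: r1 r2)
  then show "(\<lambda>k. norm (euler k h x - x - r k *\<^sub>R y)) \<longlonglongrightarrow> norm (sgrp h x - x - h *\<^sub>R y)"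
    by (intro tendsto_intros euler_tendsto h)
  have "norm (euler k h x - x - r k *\<^sub>R y) \<le> h * (h * norm z' + 2 * norm (y - z))" for k
  proof -
    have l: "(1::real) / 2 ^ k > 0" by simp
    have "norm (euler k h x - x - r k *\<^sub>R y) \<le> r k * (r k * norm z' + 2 * norm (y - z))"
      using norm_J_power_expansion_le[OF l xy zz order_refl, of "nat \<lfloor>2 ^ k * h\<rfloor>"]
      unfolding euler_def r_def .
    also have "\<dots> \<le> h * (h * norm z' + 2 * norm (y - z))"
      using r0[of k] r1[of k] h by (intro mult_mono add_mono mult_right_mono) auto
    finally show ?thesis .
  qed
  then show "\<exists>N. \<forall>k\<ge>N. norm (euler k h x - x - r k *\<^sub>R y) \<le> h * (h * norm z' + 2 * norm (y - z))"
    by blast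
qed

lemma graph_subset_generator: "A \<subseteq> generator sgrp"
proof (rule subrelI)
  fix x y assume xy: "(x, y) \<in> A"
  have "((\<lambda>h. (sgrp h x - x) /\<^sub>R h) \<longlongrightarrow> y) (at_right 0)"
  proof (rule tendstoI)
    fix e :: real assume e: "e > 0"
    obtain z z' where z: "(z, z') \<in> A" "dist z y < e / 4"
      using dense_Domain e closure_approachable[of y "Domain A"] by (auto dest!: spec[of _ "e / 4"])
    have "((\<lambda>h. h * norm z') \<longlongrightarrow> 0 * norm z') (at_right 0)" by (intro tendsto_intros)
    then have "\<forall>\<^sub>F h in at_right 0. h * norm z' < e / 2"
      using e by (intro order_tendstoD) auto
    moreover have "\<forall>\<^sub>F h::real in at_right 0. h > 0" by (simp add: eventually_at_right_less)
    ultimately show "\<forall>\<^sub>F h in at_right 0. dist ((sgrp h x - x) /\<^sub>R h) y < e"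
    proof eventually_elim
      case (elim h)
      have "(sgrp h x - x) /\<^sub>R h - y = (sgrp h x - x - h *\<^sub>R y) /\<^sub>R h"
        using elim(2) by (simp add: scaleR_diff_right)
      then have "dist ((sgrp h x - x) /\<^sub>R h) y = norm (sgrp h x - x - h *\<^sub>R y) / h"
        using elim(2) by (simp add: dist_norm divide_inverse_commute)
      also have "\<dots> \<le> h * norm z' + 2 * norm (y - z)"
        using norm_sgrp_expansion_le[OF less_imp_le[OF elim(2)] xy z(1)] elim(2)
        by (simp add: divide_le_eq mult.commute)
      also have "\<dots> < e"
        using elim(1) z(2) by (simp add: dist_norm norm_minus_commute)
      finally show ?case .
    qed
  qed
  then show "(x, y) \<in> generator sgrp" by (simp add: generator_def)
qed

lemma sgrp_tendsto: "((\<lambda>h. sgrp h f) \<longlongrightarrow> f) (at_right 0)"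
proof (rule tendstoI)
  fix e :: real assume e: "e > 0"
  obtain x y where xy: "(x, y) \<in> A" "dist x f < e / 3"
    using dense_Domain e closure_approachable[of f "Domain A"] by (auto dest!: spec[of _ "e / 3"])
  have pos: "\<forall>\<^sub>F h::real in at_right 0. h > 0" by (simp add: eventually_at_right_less)
  have "((\<lambda>h. (sgrp h x - x) /\<^sub>R h) \<longlongrightarrow> y) (at_right 0)"
    using graph_subset_generator xy(1) by (auto simp: generator_def)
  then have "((\<lambda>h. h *\<^sub>R ((sgrp h x - x) /\<^sub>R h)) \<longlongrightarrow> 0 *\<^sub>R y) (at_right 0)"
    by (intro tendsto_intros)
  then have "((\<lambda>h. sgrp h x - x) \<longlongrightarrow> 0) (at_right 0)"
    using pos by (subst (asm) tendsto_cong[where g = "\<lambda>h. sgrp h x - x"]) (auto elim: eventually_mono)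
  from tendstoD[OF this, of "e / 3"] have "\<forall>\<^sub>F h in at_right 0. norm (sgrp h x - x) < e / 3"
    using e by simp
  with pos show "\<forall>\<^sub>F h in at_right 0. dist (sgrp h f) f < e"
  proof eventually_elim
    case (elim h)
    have 2: "norm (sgrp h f - sgrp h x) < e / 3"
      using norm_sgrp_le[of h "f - x"] elim(1) xy(2)
      by (simp add: linear_diff[OF linear_sgrp] dist_norm norm_minus_commute)
    have "norm (sgrp h f - f) \<le> norm (sgrp h f - sgrp h x) + norm (sgrp h x - x) + norm (x - f)"
      using norm_triangle_ineq[of "sgrp h f - sgrp h x" "sgrp h x - x"]
        norm_triangle_ineq[of "sgrp h f - x" "x - f"] by simp
    then show ?case using elim(2) 2 xy(2) by (simp add: dist_norm)
  qed
qed

lemma C0_semigroup_sgrp: "C0_semigroup sgrp"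
  unfolding C0_semigroup_def
  by (auto simp: bounded_linear_sgrp sgrp_0 sgrp_add sgrp_tendsto fun_eq_iff)

lemma generator_sgrp: "generator sgrp = A"
proof
  \<comment> \<open>Since the semigroup is contractive, its generator is dissipative, and a dissipative extension
    of the maximally dissipative \<open>A\<close> equals \<open>A\<close>: if \<open>G\<close> is the generator, then \<open>u\<close> below satisfies
    \<open>G u = u\<close>.\<close>
  show "generator sgrp \<subseteq> A"
  proof (rule subrelI)
    fix x y assume "(x, y) \<in> generator sgrp"
    then have xy: "((\<lambda>h. (sgrp h x - x) /\<^sub>R h) \<longlongrightarrow> y) (at_right 0)" by (simp add: generator_def)
    obtain v where v: "(J 1 (x - y), v) \<in> A" "J 1 (x - y) - 1 *\<^sub>R v = x - y"
      using J_obtain[of 1 "x - y"] by auto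
    define u where "u = x - J 1 (x - y)"
    have pos: "\<forall>\<^sub>F h::real in at_right 0. h > 0" by (simp add: eventually_at_right_less)
    have "((\<lambda>h. (sgrp h (J 1 (x - y)) - J 1 (x - y)) /\<^sub>R h) \<longlongrightarrow> v) (at_right 0)"
      using graph_subset_generator v(1) by (auto simp: generator_def)
    from tendsto_diff[OF xy this]
    have "((\<lambda>h. (sgrp h u - u) /\<^sub>R h) \<longlongrightarrow> y - v) (at_right 0)"
      by (rule tendsto_cong[THEN iffD1, rotated])
        (use pos in \<open>auto elim!: eventually_mono simp: u_def linear_diff[OF linear_sgrp] simp flip: scaleR_diff_right\<close>)
    moreover have "y - v = u" using v(2) by (simp add: u_def algebra_simps)
    ultimately have "((\<lambda>h. inner u ((sgrp h u - u) /\<^sub>R h)) \<longlongrightarrow> inner u u) (at_right 0)"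
      by (intro tendsto_inner tendsto_const) simp
    moreover have "\<forall>\<^sub>F h in at_right 0. inner u ((sgrp h u - u) /\<^sub>R h) \<le> 0"
      using pos
    proof eventually_elim
      case (elim h)
      have "inner u (sgrp h u) \<le> norm u * norm (sgrp h u)" by (rule norm_cauchy_schwarz)
      also have "\<dots> \<le> norm u * norm u" using elim by (intro mult_left_mono norm_sgrp_le) auto
      also have "\<dots> = inner u u" by (simp add: power2_norm_eq_inner flip: power2_eq_square)
      finally have "inner u (sgrp h u - u) \<le> 0" by (simp add: inner_diff_right)
      then show ?case using elim by (simp add: mult_nonneg_nonpos)
    qed
    ultimately have "inner u u \<le> 0"
      by (rule tendsto_upperbound) simp
    then have "u = 0" by (metis inner_gt_zero_iff not_le)
    then have "x = J 1 (x - y)" by (simp add: u_def)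
    moreover from this v(2) have "v = y" by (simp add: algebra_simps)
    ultimately show "(x, y) \<in> A" using v(1) by simp
  qed
qed (rule graph_subset_generator)

end

section \<open>Uniqueness of the semigroup and intertwining\<close>

lemma C0_semigroupD:
  assumes "C0_semigroup T"
  shows "t \<ge> 0 \<Longrightarrow> bounded_linear (T t)" and "T 0 x = x"
    and "s \<ge> 0 \<Longrightarrow> t \<ge> 0 \<Longrightarrow> T (s + t) x = T s (T t x)"
    and "((\<lambda>t. T t x) \<longlongrightarrow> x) (at_right 0)"
  using assms by (auto simp: C0_semigroup_def)

text \<open>
  Uniform boundedness near time \<open>0\<close>, from the Baire category theorem.
\<close>

lemma C0_semigroup_bounded_near_0:
  fixes T :: "real \<Rightarrow> 'a::{real_normed_vector, complete_space} \<Rightarrow> 'a"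
  assumes T: "C0_semigroup T"
  obtains \<delta> C where "\<delta> > 0" "C \<ge> 0" "\<And>s x. 0 \<le> s \<Longrightarrow> s \<le> \<delta> \<Longrightarrow> norm (T s x) \<le> C * norm x"
proof -
  define F where "F n = {x. \<forall>s\<in>{0..1 / Suc n}. norm (T s x) \<le> real n}" for n
  have closed: "closed (F n)" for n
  proof -
    have "closed {x. norm (T s x) \<le> real n}" if "s \<ge> 0" for s
      by (intro closed_Collect_le continuous_intros
          bounded_linear.continuous_on[OF C0_semigroupD(1)[OF T that]])
    then have "closed (\<Inter>s\<in>{0..1 / Suc n}. {x. norm (T s x) \<le> real n})"
      by (intro closed_INT) simp
    also have "(\<Inter>s\<in>{0..1 / Suc n}. {x. norm (T s x) \<le> real n}) = F n"
      by (auto simp: F_def)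
    finally show ?thesis .
  qed
  have cover: "x \<in> (\<Union>n. F n)" for x
  proof -
    have "((\<lambda>s. norm (T s x)) \<longlongrightarrow> norm x) (at_right 0)"
      by (intro tendsto_norm C0_semigroupD(4)[OF T])
    then have "\<forall>\<^sub>F s in at_right 0. norm (T s x) < norm x + 1"
      by (intro order_tendstoD) auto
    then obtain b where b: "b > 0" "\<And>s. 0 < s \<Longrightarrow> s < b \<Longrightarrow> norm (T s x) < norm x + 1"
      unfolding eventually_at_right_field by auto
    obtain n :: nat where n: "max (norm x + 1) (1 / b) < n" using reals_Archimedean2 by blast
    have "1 / Suc n < b"
    proof -
      have "1 / b < Suc n" using n by simp
      then show ?thesis using b(1) by (simp add: field_simps)
    qed
    then have "norm (T s x) \<le> n" if "s \<in> {0..1 / Suc n}" for s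
      using that n b(2)[of s] C0_semigroupD(2)[OF T, of x] by (cases "s = 0") auto
    then have "x \<in> F n" unfolding F_def by blast
    then show ?thesis by blast
  qed
  have "\<exists>n. interior (F n) \<noteq> {}"
  proof (rule ccontr)
    assume "\<not> ?thesis"
    then have "euclidean interior_of (\<Union>(range F)) = {}"
      by (intro Baire_category_alt) (auto simp: closed completely_metrizable_space_euclidean)
    moreover have "\<Union>(range F) = UNIV" using cover by auto
    ultimately show False by simp
  qed
  then obtain n x\<^sub>0 where "x\<^sub>0 \<in> interior (F n)" by blast
  then obtain r where r: "r > 0" "ball x\<^sub>0 r \<subseteq> F n" by (auto simp: mem_interior)
  have "norm (T s y) \<le> (4 * n / r) * norm y" if s: "0 \<le> s" "s \<le> 1 / Suc n" for s y
  proof (cases "y = 0")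
    case True
    then show ?thesis using bounded_linear.linear[OF C0_semigroupD(1)[OF T s(1)]] by (simp add: linear_0)
  next
    case False
    define c where "c = r / 2 / norm y"
    have c: "c > 0" using False r(1) by (simp add: c_def)
    have lin: "linear (T s)" using C0_semigroupD(1)[OF T s(1)] by (rule bounded_linear.linear)
    have FD: "norm (T s z) \<le> n" if "z \<in> F n" for z
      using that s unfolding F_def by simp
    have "x\<^sub>0 + c *\<^sub>R y \<in> ball x\<^sub>0 r" "x\<^sub>0 \<in> ball x\<^sub>0 r"
      using r(1) False by (simp_all add: dist_norm c_def)
    then have "norm (T s (x\<^sub>0 + c *\<^sub>R y)) \<le> n" "norm (T s x\<^sub>0) \<le> n"
      using r(2) FD by blast+
    then have "norm (T s (x\<^sub>0 + c *\<^sub>R y) - T s x\<^sub>0) \<le> real n + real n"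
      by (intro order_trans[OF norm_triangle_ineq4] add_mono)
    also have "T s (x\<^sub>0 + c *\<^sub>R y) - T s x\<^sub>0 = c *\<^sub>R T s y"
      by (simp add: linear_add[OF lin] linear_scale[OF lin])
    finally have "c * norm (T s y) \<le> 2 * n" using c by simp
    then show ?thesis using False r(1) by (simp add: c_def field_simps)
  qed
  then show thesis using that[of "1 / Suc n" "4 * n / r"] r(1) by simp
qed

context m_dissipative
begin

text \<open>
  Uniqueness of the semigroup generated by \<open>A\<close>.  A competitor \<open>S\<close> commutes with its generator, hence
  with the resolvents and with their limit \<open>sgrp\<close>.
\<close>

lemma J_commute_semigroup:
  assumes S: "C0_semigroup S" and gen: "generator S = A" and s: "s \<ge> 0" and l: "l > 0"
  shows "J l (S s f) = S s (J l f)"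
proof -
  have bl: "bounded_linear (S s)" using C0_semigroupD(1)[OF S s] .
  note lin = bounded_linear.linear[OF bl]
  obtain v where v: "(J l f, v) \<in> A" "J l f - l *\<^sub>R v = f" using J_obtain[OF l] .
  have "((\<lambda>h. S s ((S h (J l f) - J l f) /\<^sub>R h)) \<longlongrightarrow> S s v) (at_right 0)"
    using v(1) unfolding gen[symmetric] generator_def by (auto intro: bounded_linear.tendsto[OF bl])
  moreover have "\<forall>\<^sub>F h::real in at_right 0. h > 0" by (simp add: eventually_at_right_less)
  then have "\<forall>\<^sub>F h in at_right 0. S s ((S h (J l f) - J l f) /\<^sub>R h) = (S h (S s (J l f)) - S s (J l f)) /\<^sub>R h"
  proof eventually_elim
    case (elim h)
    have "S s (S h (J l f)) = S h (S s (J l f))"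
      using C0_semigroupD(3)[OF S s, of h "J l f"] C0_semigroupD(3)[OF S _ s, of h "J l f"] elim
      by (simp add: add.commute)
    then show ?case by (simp add: linear_scale[OF lin] linear_diff[OF lin])
  qed
  ultimately have "((\<lambda>h. (S h (S s (J l f)) - S s (J l f)) /\<^sub>R h) \<longlongrightarrow> S s v) (at_right 0)"
    by (rule Lim_transform_eventually)
  then have "(S s (J l f), S s v) \<in> A" unfolding gen[symmetric] generator_def by simp
  moreover have "S s (J l f) - l *\<^sub>R S s v = S s f"
    by (subst (2) v(2)[symmetric]) (simp only: linear_scale[OF lin] linear_diff[OF lin])
  ultimately show ?thesis by (rule J_eqI[OF _ _ l])
qed

lemma sgrp_commute_semigroup:
  assumes S: "C0_semigroup S" and gen: "generator S = A" and s: "s \<ge> 0" and t: "t \<ge> 0"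
  shows "sgrp t (S s f) = S s (sgrp t f)"
proof -
  have "(J l ^^ n) (S s f) = S s ((J l ^^ n) f)" if "l > 0" for l n
    by (induction n) (simp_all add: J_commute_semigroup[OF S gen s that])
  then have "euler k t (S s f) = S s (euler k t f)" for k
    by (simp add: euler_def)
  then have "(\<lambda>k. euler k t (S s f)) \<longlonglongrightarrow> S s (sgrp t f)"
    using bounded_linear.tendsto[OF C0_semigroupD(1)[OF S s] euler_tendsto[OF t]] by simp
  then show ?thesis using euler_tendsto[OF t] LIMSEQ_unique by blast
qed

lemma semigroup_eq_sgrp_near_0:
  assumes S: "C0_semigroup S" and gen: "generator S = A"
    and C: "C \<ge> 0" "\<And>s x. 0 \<le> s \<Longrightarrow> s \<le> \<delta> \<Longrightarrow> norm (S s x) \<le> C * norm x"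
    and t: "0 < t" "t \<le> \<delta>"
  shows "S t x = sgrp t x"
proof -
  have "S t x = sgrp t x" if xy: "(x, y) \<in> A" for x y
  proof -
    define r where "r h = (S h x - x) /\<^sub>R h - (sgrp h x - x) /\<^sub>R h" for h
    have "(r \<longlongrightarrow> y - y) (at_right 0)"
      unfolding r_def using xy gen generator_sgrp
      by (intro tendsto_diff) (auto simp: generator_def)
    then have r: "(r \<longlongrightarrow> 0) (at_right 0)" by simp
    \<comment> \<open>Telescoping; as both semigroups commute, only the local error at \<open>x\<close> itself enters.\<close>
    have tele: "norm (S (k * h) x - sgrp (k * h) x) \<le> k * (C * norm (S h x - sgrp h x))"
      if h: "0 < h" and "k * h \<le> \<delta>" for k :: nat and h :: real
      using that(2)
    proof (induction k)
      case 0
      then show ?case by (simp add: C0_semigroupD(2)[OF S] sgrp_0)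
    next
      case (Suc k)
      have kh: "0 \<le> k * h" "k * h \<le> \<delta>" using Suc.prems h by (auto simp: distrib_right)
      have S1: "S (Suc k * h) x = S (k * h) (S h x)"
        using C0_semigroupD(3)[OF S kh(1), of h x] h by (simp add: algebra_simps)
      have T1: "sgrp (Suc k * h) x = sgrp h (sgrp (k * h) x)"
        using sgrp_add[of h "k * h" x] h kh by (simp add: algebra_simps)
      have "S (Suc k * h) x - sgrp (Suc k * h) x
          = S (k * h) (S h x - sgrp h x) + sgrp h (S (k * h) x - sgrp (k * h) x)"
        unfolding S1 T1 using h kh(1)
        by (simp add: linear_diff[OF bounded_linear.linear[OF C0_semigroupD(1)[OF S kh(1)]]]
            linear_diff[OF linear_sgrp] sgrp_commute_semigroup[OF S gen])
      then have "norm (S (Suc k * h) x - sgrp (Suc k * h) x)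
          \<le> norm (S (k * h) (S h x - sgrp h x)) + norm (sgrp h (S (k * h) x - sgrp (k * h) x))"
        by (simp only: norm_triangle_ineq)
      also have "\<dots> \<le> C * norm (S h x - sgrp h x) + norm (S (k * h) x - sgrp (k * h) x)"
        using h by (intro add_mono C(2) kh norm_sgrp_le) simp
      also have "\<dots> \<le> C * norm (S h x - sgrp h x) + k * (C * norm (S h x - sgrp h x))"
        by (intro add_left_mono Suc.IH kh)
      finally show ?case by (simp add: algebra_simps)
    qed
    have le: "norm (S t x - sgrp t x) \<le> t * C * norm (r (t / Suc n))" for n
    proof -
      have h: "0 < t / Suc n" using t(1) by simp
      have "norm (S t x - sgrp t x) \<le> Suc n * (C * norm (S (t / Suc n) x - sgrp (t / Suc n) x))"
        using tele[OF h, of "Suc n"] t(2) by (simp del: of_nat_Suc)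
      also have "S (t / Suc n) x - sgrp (t / Suc n) x = (t / Suc n) *\<^sub>R r (t / Suc n)"
        unfolding r_def using t(1) by (simp add: scaleR_diff_right del: of_nat_Suc)
      finally show ?thesis using t(1) by (simp add: mult_ac del: of_nat_Suc)
    qed
    have "filterlim (\<lambda>n. t / Suc n) (at_right 0) sequentially"
    proof (rule tendsto_imp_filterlim_at_right)
      show "(\<lambda>n. t / Suc n) \<longlonglongrightarrow> 0"
        using tendsto_mult_right_zero[OF LIMSEQ_inverse_real_of_nat, of t] by (simp add: divide_inverse)
    qed (use t(1) in simp)
    then have "(\<lambda>n. r (t / Suc n)) \<longlonglongrightarrow> 0" by (rule filterlim_compose[OF r])
    then have "(\<lambda>n. t * C * norm (r (t / Suc n))) \<longlonglongrightarrow> 0"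
      by (intro tendsto_mult_right_zero tendsto_norm_zero)
    then have "norm (S t x - sgrp t x) \<le> 0"
      by (rule LIMSEQ_le_const) (use le in blast)
    then show ?thesis by simp
  qed
  note on_Domain = this
  have t0: "0 \<le> t" using t(1) by simp
  show ?thesis
    by (rule bounded_linear_eqI_Domain[OF C0_semigroupD(1)[OF S t0] bounded_linear_sgrp[OF t0] on_Domain])
qed

lemma semigroup_eq_sgrp:
  assumes S: "C0_semigroup S" and gen: "generator S = A" and t: "t \<ge> 0"
  shows "S t = sgrp t"
proof
  fix x
  obtain \<delta> C where \<delta>: "\<delta> > 0" and C: "C \<ge> 0" "\<And>s x. 0 \<le> s \<Longrightarrow> s \<le> \<delta> \<Longrightarrow> norm (S s x) \<le> C * norm x"
    using C0_semigroup_bounded_near_0[OF S] by blast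
  show "S t x = sgrp t x"
  proof (cases "t = 0")
    case True
    then show ?thesis by (simp add: C0_semigroupD(2)[OF S] sgrp_0)
  next
    case False
    obtain n :: nat where n: "t / \<delta> < n" using reals_Archimedean2 by blast
    have "0 < t / \<delta>" using False t \<delta> by simp
    then have n0: "0 < real n" using n by linarith
    define h where "h = t / n"
    have h: "0 < h" "h \<le> \<delta>"
      using n n0 \<delta> False t by (simp_all add: h_def field_simps)
    have "S (k * h) x = sgrp (k * h) x" for k :: nat
    proof (induction k)
      case (Suc k)
      have kh: "0 \<le> k * h" using h by simp
      have "S (h + k * h) x = sgrp (h + k * h) x"
        using h kh Suc by (simp add: C0_semigroupD(3)[OF S] sgrp_add semigroup_eq_sgrp_near_0[OF S gen C])
      then show ?case by (simp add: algebra_simps)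
    qed (simp add: C0_semigroupD(2)[OF S] sgrp_0)
    from this[of n] show ?thesis using n0 by (simp add: h_def)
  qed
qed

lemma op_exp_eq_sgrp:
  assumes t: "t \<ge> 0"
  shows "op_exp t A = sgrp t"
  unfolding op_exp_def
proof (rule the_equality)
  show "\<exists>T. C0_semigroup T \<and> generator T = A \<and> sgrp t = T t"
    using C0_semigroup_sgrp generator_sgrp by blast
  fix S assume "\<exists>T. C0_semigroup T \<and> generator T = A \<and> S = T t"
  then obtain T where T: "C0_semigroup T" "generator T = A" "S = T t" by blast
  show "S = sgrp t" unfolding T(3) by (rule semigroup_eq_sgrp[OF T(1,2) t])
qed

end

text \<open>
  An intertwining relation of the resolvents passes to the Euler approximations by iteration, and
  to the semigroups because \<open>d\<close> is closed.
\<close>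

lemma op_exp_intertwine:
  assumes A: "m_dissipative A" and B: "m_dissipative B"
    and closed: "closed d"
    and resolvents: "\<And>l f g. l > 0 \<Longrightarrow> (f, g) \<in> d \<Longrightarrow> (m_dissipative.J A l f, m_dissipative.J B l g) \<in> d"
    and fg: "(f, g) \<in> d" and t: "t \<ge> 0"
  shows "(op_exp t A f, op_exp t B g) \<in> d"
proof -
  interpret A: m_dissipative A by fact
  interpret B: m_dissipative B by fact
  have "((A.J l ^^ n) f, (B.J l ^^ n) g) \<in> d" if "l > 0" for l n
    by (induction n) (simp_all add: fg resolvents[OF that])
  then have "(A.euler k t f, B.euler k t g) \<in> d" for k
    by (simp add: A.euler_def B.euler_def)
  then have "(A.sgrp t f, B.sgrp t g) \<in> d"
    by (rule closed_sequentially[OF closed _ tendsto_Pair[OF A.euler_tendsto[OF t] B.euler_tendsto[OF t]]])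
  then show ?thesis by (simp only: A.op_exp_eq_sgrp[OF t] B.op_exp_eq_sgrp[OF t])
qed

section \<open>The operators \<open>- d\<^sup>* d\<close> and \<open>- d d\<^sup>*\<close>\<close>

text \<open>
  A closed, densely defined linear operator between Hilbert spaces, given by its graph.
\<close>

locale closed_densely_defined =
  fixes d :: "('a::{real_inner, complete_space} \<times> 'b::{real_inner, complete_space}) set"
  assumes subspace_graph: "subspace d"
    and closed_graph: "closed d"
    and single_valued_0: "(0, w) \<in> d \<Longrightarrow> w = 0"
    and dense_Domain: "closure (Domain d) = UNIV"

lemma op_adjoint_iff: "(y, z) \<in> op_adjoint d \<longleftrightarrow> (\<forall>(x, w)\<in>d. inner w y = inner x z)"
  by (simp add: op_adjoint_def)

lemma op_adjointD: "(y, z) \<in> op_adjoint d \<Longrightarrow> (x, w) \<in> d \<Longrightarrow> inner w y = inner x z"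
  unfolding op_adjoint_iff by blast

lemma subspace_op_adjoint: "subspace (op_adjoint d)"
  by (rule subspaceI)
    (auto simp: op_adjoint_def inner_add_right zero_prod_def split_beta)

lemma closed_op_adjoint: "closed (op_adjoint d)"
proof -
  have "closed (\<Inter>p\<in>d. {q. inner (snd p) (fst q) = inner (fst p) (snd q)})"
    by (intro closed_INT ballI closed_Collect_eq continuous_intros)
  also have "(\<Inter>p\<in>d. {q. inner (snd p) (fst q) = inner (fst p) (snd q)}) = op_adjoint d"
    by (force simp: op_adjoint_def split_beta)
  finally show ?thesis .
qed

context closed_densely_defined
begin

lemma op_adjoint_op_adjoint: "op_adjoint (op_adjoint d) = d"
proof
  show "d \<subseteq> op_adjoint (op_adjoint d)"
  proof (rule subrelI)
    fix x w assume "(x, w) \<in> d"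
    then have "inner z x = inner y w" if "(y, z) \<in> op_adjoint d" for y z
      using op_adjointD[OF that] by (simp add: inner_commute)
    then show "(x, w) \<in> op_adjoint (op_adjoint d)" by (auto simp: op_adjoint_iff)
  qed
  show "op_adjoint (op_adjoint d) \<subseteq> d"
  proof (rule subrelI)
    fix x w assume xw: "(x, w) \<in> op_adjoint (op_adjoint d)"
    \<comment> \<open>The component \<open>(a, b)\<close> of \<open>(x, w)\<close> orthogonal to \<open>d\<close> vanishes: orthogonality means that
      \<open>(b, - a)\<close> is in \<open>d\<^sup>*\<close>, and it can then be tested against \<open>(x, w)\<close>.\<close>
    obtain p where p: "p \<in> d" "\<And>q. q \<in> d \<Longrightarrow> inner ((x, w) - p) q = 0"
      using closed_subspace_orthogonal_projection[where x = "(x, w)", OF closed_graph subspace_graph]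
      by blast
    define a b where "a = x - fst p" and "b = w - snd p"
    have ab: "inner a y + inner b v = 0" if "(y, v) \<in> d" for y v
      using p(2)[OF that] by (cases p) (simp add: a_def b_def)
    have "inner v b = inner y (- a)" if "(y, v) \<in> d" for y v
      using ab[OF that] by (simp add: inner_commute)
    then have ba: "(b, - a) \<in> op_adjoint d" by (auto simp: op_adjoint_iff)
    have "inner (- a) x = inner b w" using op_adjointD[OF xw ba] .
    moreover have "inner a (fst p) + inner b (snd p) = 0" using ab[of "fst p" "snd p"] p(1) by simp
    ultimately have "inner a a + inner b b = 0"
      unfolding a_def b_def by (simp add: inner_diff_left inner_diff_right inner_commute algebra_simps)
    then have "a = 0" "b = 0"
      using inner_ge_zero[of a] inner_ge_zero[of b]
      by (metis add_nonneg_eq_0_iff inner_eq_zero_iff)+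
    then have "(x, w) = p" by (cases p) (simp add: a_def b_def)
    then show "(x, w) \<in> d" using p(1) by simp
  qed
qed

lemma op_adjoint_single_valued_0: "(0, z) \<in> op_adjoint d \<Longrightarrow> z = 0"
  using inner_eq_zero_if_dense[OF dense_Domain, of z] op_adjointD[of 0 z d]
  by (auto simp: inner_commute)

lemma closed_densely_defined_op_adjoint: "closed_densely_defined (op_adjoint d)"
proof
  show "subspace (op_adjoint d)" by (rule subspace_op_adjoint)
  show "closed (op_adjoint d)" by (rule closed_op_adjoint)
  show "w = 0" if "(0, w) \<in> op_adjoint d" for w
    using that by (rule op_adjoint_single_valued_0)
  show "closure (Domain (op_adjoint d)) = UNIV"
  proof (rule closure_subspace_eq_UNIV_if_trivial_complement)
    show "subspace (Domain (op_adjoint d))"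
      using subspace_op_adjoint[of d] unfolding subspace_def
      by (auto simp: zero_prod_def) (metis Domain.DomainI add_Pair, metis Domain.DomainI scaleR_Pair)
  next
    fix z assume "\<And>s. s \<in> Domain (op_adjoint d) \<Longrightarrow> inner z s = 0"
    then have "(0, z) \<in> op_adjoint (op_adjoint d)"
      by (auto simp: op_adjoint_iff inner_commute)
    then show "z = 0" unfolding op_adjoint_op_adjoint by (rule single_valued_0)
  qed
qed

text \<open>
  Von Neumann's theorem: \<open>1 + l d\<^sup>* d\<close> is onto.  The solution is the projection of \<open>(f, 0)\<close> onto
  the graph of \<open>\<surd>l d\<close>.
\<close>

lemma resolvent_form_laplacian_adjoint:
  assumes l: "l > 0"
  obtains u w z where "(u, w) \<in> d" "(w, z) \<in> op_adjoint d" "u + l *\<^sub>R z = f"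
proof -
  define r where "r = sqrt l"
  have r: "r > 0" "r * r = l" using l by (simp_all add: r_def)
  define G where "G = {p. (fst p, (1 / r) *\<^sub>R snd p) \<in> d}"
  have "closed ((\<lambda>p. (fst p, (1 / r) *\<^sub>R snd p)) -` d)"
    by (intro closed_vimage closed_graph continuous_intros)
  then have "closed G" by (simp add: G_def vimage_def)
  have "subspace G"
  proof (rule subspaceI)
    show "0 \<in> G" using subspace_0[OF subspace_graph] by (simp add: G_def zero_prod_def)
    show "p + q \<in> G" if "p \<in> G" "q \<in> G" for p q
      using subspace_add[OF subspace_graph, of "(fst p, (1 / r) *\<^sub>R snd p)" "(fst q, (1 / r) *\<^sub>R snd q)"] that
      by (simp add: G_def scaleR_add_right)
    show "c *\<^sub>R p \<in> G" if "p \<in> G" for c p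
      using subspace_scale[OF subspace_graph, of "(fst p, (1 / r) *\<^sub>R snd p)" c] that
      by (simp add: G_def)
  qed
  obtain p where p: "p \<in> G" "\<And>q. q \<in> G \<Longrightarrow> inner ((f, 0) - p) q = 0"
    using closed_subspace_orthogonal_projection[where x = "(f, 0)", OF \<open>closed G\<close> \<open>subspace G\<close>]
    by blast
  define u w where "u = fst p" and "w = (1 / r) *\<^sub>R snd p"
  have uw: "(u, w) \<in> d" using p(1) by (simp add: G_def u_def w_def)
  have p_eq: "p = (u, r *\<^sub>R w)" using r(1) by (simp add: u_def w_def)
  have "inner v w = inner y ((1 / l) *\<^sub>R (f - u))" if "(y, v) \<in> d" for y v
  proof -
    have "(y, r *\<^sub>R v) \<in> G" using that r(1) by (simp add: G_def)
    from p(2)[OF this] have "inner (f - u) y = l * inner w v"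
      using r(2) by (simp add: p_eq mult.assoc[symmetric])
    then show ?thesis using l by (simp add: inner_commute)
  qed
  then have "(w, (1 / l) *\<^sub>R (f - u)) \<in> op_adjoint d" by (auto simp: op_adjoint_iff)
  moreover have "u + l *\<^sub>R ((1 / l) *\<^sub>R (f - u)) = f" using l by simp
  ultimately show thesis by (rule that[OF uw])
qed

text \<open>
  As \<open>d\<^sup>*\<^sup>* = d\<close>, the operator \<^term>\<open>form_laplacian (op_adjoint d)\<close> is \<open>- d\<^sup>* d\<close>.  Every statement on
  \<open>- d\<^sup>* d\<close> therefore yields one on \<open>- d d\<^sup>*\<close>, on replacing \<open>d\<close> by \<open>d\<^sup>*\<close>.
\<close>

lemma form_laplacian_adjoint_iff:
  "(x, y) \<in> form_laplacian (op_adjoint d) \<longleftrightarrow> (\<exists>w. (x, w) \<in> d \<and> (w, - y) \<in> op_adjoint d)"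
proof
  assume "\<exists>w. (x, w) \<in> d \<and> (w, - y) \<in> op_adjoint d"
  then have "(x, - y) \<in> d O op_adjoint d" by blast
  then show "(x, y) \<in> form_laplacian (op_adjoint d)"
    unfolding form_laplacian_def op_adjoint_op_adjoint by force
qed (auto simp: form_laplacian_def op_adjoint_op_adjoint)

lemma m_dissipative_adjoint: "m_dissipative (form_laplacian (op_adjoint d))"
proof
  note iff = form_laplacian_adjoint_iff
  show "subspace (form_laplacian (op_adjoint d))"
  proof (rule subspaceI)
    show "0 \<in> form_laplacian (op_adjoint d)"
      using subspace_0[OF subspace_graph] subspace_0[OF subspace_op_adjoint, of d]
      by (auto simp: iff zero_prod_def)
  next
    fix p q assume pq: "p \<in> form_laplacian (op_adjoint d)" "q \<in> form_laplacian (op_adjoint d)"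
    obtain x y x' y' where [simp]: "p = (x, y)" "q = (x', y')" by (cases p, cases q)
    obtain w w' where w: "(x, w) \<in> d" "(w, - y) \<in> op_adjoint d" "(x', w') \<in> d" "(w', - y') \<in> op_adjoint d"
      using pq iff by auto
    have "(x + x', w + w') \<in> d" "(w + w', - y + - y') \<in> op_adjoint d"
      using subspace_add[OF subspace_graph w(1,3)] subspace_add[OF subspace_op_adjoint w(2,4)] by simp_all
    then show "p + q \<in> form_laplacian (op_adjoint d)" by (auto simp: iff)
  next
    fix c p assume p: "p \<in> form_laplacian (op_adjoint d)"
    obtain x y where [simp]: "p = (x, y)" by (cases p)
    obtain w where w: "(x, w) \<in> d" "(w, - y) \<in> op_adjoint d" using p iff by auto
    have "(c *\<^sub>R x, c *\<^sub>R w) \<in> d" "(c *\<^sub>R w, c *\<^sub>R - y) \<in> op_adjoint d"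
      using subspace_scale[OF subspace_graph w(1)] subspace_scale[OF subspace_op_adjoint w(2)] by simp_all
    then show "c *\<^sub>R p \<in> form_laplacian (op_adjoint d)" by (auto simp: iff)
  qed
  show "y = 0" if "(0, y) \<in> form_laplacian (op_adjoint d)" for y
    using that single_valued_0 op_adjoint_single_valued_0 unfolding iff
    by (metis neg_equal_0_iff_equal)
  show "inner x y \<le> 0" if "(x, y) \<in> form_laplacian (op_adjoint d)" for x y
  proof -
    obtain w where w: "(x, w) \<in> d" "(w, - y) \<in> op_adjoint d" using \<open>(x, y) \<in> _\<close> iff by auto
    have "inner w w = inner x (- y)" by (rule op_adjointD[OF w(2,1)])
    then show ?thesis using inner_ge_zero[of w] by simp
  qed
  show "\<exists>x y. (x, y) \<in> form_laplacian (op_adjoint d) \<and> x - l *\<^sub>R y = f" if l: "l > 0" for l f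
  proof -
    obtain u w z where "(u, w) \<in> d" "(w, z) \<in> op_adjoint d" "u + l *\<^sub>R z = f"
      using resolvent_form_laplacian_adjoint[OF l] .
    then show ?thesis by (intro exI[of _ u] exI[of _ "- z"]) (auto simp: iff)
  qed
qed

end

lemma (in closed_densely_defined) m_dissipative_form_laplacian: "m_dissipative (form_laplacian d)"
  using closed_densely_defined.m_dissipative_adjoint[OF closed_densely_defined_op_adjoint]
  unfolding op_adjoint_op_adjoint .

lemma (in closed_densely_defined) op_exp_intertwine_form_laplacian:
  assumes fg: "(f, g) \<in> d" and t: "t \<ge> 0"
  shows "(op_exp t (form_laplacian (op_adjoint d)) f, op_exp t (form_laplacian d) g) \<in> d"
proof (rule op_exp_intertwine[OF m_dissipative_adjoint m_dissipative_form_laplacian closed_graph _ fg t])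
  fix l :: real and f g assume l: "l > 0" and fg: "(f, g) \<in> d"
  interpret A: m_dissipative "form_laplacian (op_adjoint d)" by (rule m_dissipative_adjoint)
  interpret B: m_dissipative "form_laplacian d" by (rule m_dissipative_form_laplacian)
  \<comment> \<open>From \<open>u + l d\<^sup>* d u = f\<close> the element \<open>d\<^sup>* d u\<close> lies in the domain of \<open>d\<close>, so \<open>d\<close> can be applied to
    the equation; it becomes the resolvent equation of \<open>- d d\<^sup>*\<close> for \<open>w = d u\<close>.\<close>
  obtain u w z where u: "(u, w) \<in> d" "(w, z) \<in> op_adjoint d" "u + l *\<^sub>R z = f"
    using resolvent_form_laplacian_adjoint[OF l] .
  have "(u, - z) \<in> form_laplacian (op_adjoint d)"
    using u unfolding form_laplacian_def op_adjoint_op_adjoint by auto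
  then have J1: "A.J l f = u" using u(3) l by (intro A.J_eqI[of _ "- z"]) auto
  have z: "z = (1 / l) *\<^sub>R (f - u)" using u(3) l by auto
  have "(z, (1 / l) *\<^sub>R (g - w)) \<in> d"
    using subspace_scale[OF subspace_graph subspace_diff[OF subspace_graph fg u(1)], of "1 / l"]
    unfolding z by simp
  then have "(w, - ((1 / l) *\<^sub>R (g - w))) \<in> form_laplacian d"
    using u(2) unfolding form_laplacian_def by auto
  then have "B.J l g = w" using l by (intro B.J_eqI[of _ "- ((1 / l) *\<^sub>R (g - w))"]) auto
  then show "(A.J l f, B.J l g) \<in> d" using J1 u(1) by simp
qed

lemma (in closed_densely_defined) op_app_eqI: "(x, y) \<in> d \<Longrightarrow> op_app d x = y"
  unfolding op_app_def
proof (rule the_equality)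
  fix z assume "(x, y) \<in> d" "(x, z) \<in> d"
  then have "(0, z - y) \<in> d" using subspace_diff[OF subspace_graph, of "(x, z)" "(x, y)"] by simp
  then show "z = y" using single_valued_0 by force
qed

section \<open>The exterior derivative\<close>

context metric_measure_space
begin

lemma emeasure_compact_finite:
  assumes "compact K"
  shows "emeasure M K < \<infinity>"
proof -
  obtain U where U: "\<And>x. open (U x) \<and> x \<in> U x \<and> emeasure M (U x) < \<infinity>"
    using locally_finite by metis
  obtain F where F: "F \<subseteq> K" "finite F" "K \<subseteq> (\<Union>x\<in>F. U x)"
    using compactE_image[OF assms, of K U] U by blast
  have meas: "U x \<in> sets M" for x using U sets_M by auto
  have "emeasure M K \<le> emeasure M (\<Union>x\<in>F. U x)"
    using meas F by (intro emeasure_mono) auto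
  also have "\<dots> \<le> (\<Sum>x\<in>F. emeasure M (U x))"
    using meas F(2) by (intro emeasure_subadditive_finite) auto
  also have "\<dots> < \<infinity>" using U F(2) by (simp add: less_top[symmetric])
  finally show ?thesis .
qed

lemma Cc_bounded: "f \<in> Cc \<Longrightarrow> bounded (range f)"
proof -
  assume f: "f \<in> Cc"
  let ?K = "closure {x. f x \<noteq> 0}"
  have "bounded (f ` ?K)"
    using f by (intro compact_imp_bounded compact_continuous_image)
      (auto simp: Cc_def intro: continuous_on_subset)
  moreover have "range f \<subseteq> insert 0 (f ` ?K)" using closure_subset[of "{x. f x \<noteq> 0}"] by auto
  ultimately show ?thesis using bounded_subset bounded_insert by metis
qed

lemma Cc_sq_integrable:
  assumes f: "f \<in> Cc"
  shows "f \<in> sq_integrable M"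
proof -
  let ?K = "closure {x. f x \<noteq> 0}"
  obtain b where b: "\<And>x. \<bar>f x\<bar> \<le> b" using Cc_bounded[OF f] by (auto simp: bounded_iff)
  have "f \<in> borel_measurable borel" using f by (auto simp: Cc_def intro: borel_measurable_continuous_onI)
  then have meas: "f \<in> borel_measurable M" using measurable_cong_sets[OF sets_M refl] by blast
  have "compact ?K" using f by (simp add: Cc_def)
  then have "?K \<in> sets M" "emeasure M ?K < \<infinity>"
    using emeasure_compact_finite by (auto simp: sets_M compact_imp_closed)
  then have int: "integrable M (\<lambda>x. b\<^sup>2 * indicator ?K x :: real)" by (auto simp: less_top[symmetric])
  have bound: "norm ((f x)\<^sup>2) \<le> norm (b\<^sup>2 * indicator ?K x)" for x
  proof (cases "x \<in> ?K")
    case True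
    have "\<bar>f x\<bar> \<le> \<bar>b\<bar>" using b[of x] by simp
    then have "(f x)\<^sup>2 \<le> b\<^sup>2" by (simp only: abs_le_square_iff)
    then show ?thesis using True by simp
  next
    case False
    have "f x = 0"
    proof (rule ccontr)
      assume "f x \<noteq> 0"
      then have "x \<in> ?K" by (intro subsetD[OF closure_subset]) simp
      with False show False by contradiction
    qed
    then show ?thesis by simp
  qed
  have "(\<lambda>x. (f x)\<^sup>2) \<in> borel_measurable M" using meas by simp
  then have "integrable M (\<lambda>x. (f x)\<^sup>2)"
    by (rule Bochner_Integration.integrable_bound[OF int _ AE_I2]) (rule bound)
  then show ?thesis using meas by (simp add: sq_integrable_def)
qed

end

context dirichlet_form
begin

lemma E_add_right: "u \<in> D \<Longrightarrow> v \<in> D \<Longrightarrow> w \<in> D \<Longrightarrow> E u (v + w) = E u v + E u w"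
  using E_add[of v w u] E_sym subspace_add[OF subspace_D] by simp

lemma E_scale_right: "u \<in> D \<Longrightarrow> v \<in> D \<Longrightarrow> E u (c *\<^sub>R v) = c * E u v"
  using E_scale[of v u c] E_sym subspace_scale[OF subspace_D] by simp

lemma E_diff_left: "u \<in> D \<Longrightarrow> v \<in> D \<Longrightarrow> w \<in> D \<Longrightarrow> E (u - v) w = E u w - E v w"
  using E_add[of u "(- 1) *\<^sub>R v" w] E_scale[of v w "- 1"] subspace_scale[OF subspace_D, of v "- 1"] by simp

lemma E_diff_right: "u \<in> D \<Longrightarrow> v \<in> D \<Longrightarrow> w \<in> D \<Longrightarrow> E u (v - w) = E u v - E u w"
  using E_diff_left[of v w u] E_sym subspace_diff[OF subspace_D] by simp

lemma E_Cauchy_Schwarz: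
  assumes u: "u \<in> D" and v: "v \<in> D"
  shows "\<bar>E u v\<bar> \<le> sqrt (E u u) * sqrt (E v v)"
proof -
  have quad: "0 \<le> E u u * c\<^sup>2 + 2 * E u v * c + E v v" for c
  proof -
    have cu: "c *\<^sub>R u \<in> D" by (rule subspace_scale[OF subspace_D u])
    have "0 \<le> E (c *\<^sub>R u + v) (c *\<^sub>R u + v)"
      by (intro E_nonneg subspace_add subspace_D cu v)
    also have "\<dots> = E u u * c\<^sup>2 + 2 * E u v * c + E v v"
      using u v cu subspace_add[OF subspace_D cu v]
      by (simp add: E_add E_add_right E_scale E_scale_right E_sym[OF v u] power2_eq_square algebra_simps)
    finally show ?thesis .
  qed
  have "(E u v)\<^sup>2 \<le> E u u * E v v"
  proof (cases "E u u = 0")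
    case True
    have "E u v = 0"
    proof (rule ccontr)
      assume ne: "E u v \<noteq> 0"
      have "0 \<le> 2 * E u v * (- (E v v + 1) / (2 * E u v)) + E v v"
        using quad[of "- (E v v + 1) / (2 * E u v)"] True by simp
      also have "\<dots> = - 1" using ne by (simp add: field_simps)
      finally show False by simp
    qed
    then show ?thesis using True by simp
  next
    case False
    then have pos: "E u u > 0" using E_nonneg[OF u] by simp
    have "0 \<le> E u u * (- E u v / E u u)\<^sup>2 + 2 * E u v * (- E u v / E u u) + E v v"
      by (rule quad)
    also have "\<dots> = E v v - (E u v)\<^sup>2 / E u u"
      using False by (simp add: power2_eq_square field_simps)
    finally show ?thesis using pos by (simp add: field_simps)
  qed
  then have "sqrt ((E u v)\<^sup>2) \<le> sqrt (E u u * E v v)" by (rule real_sqrt_le_mono)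
  then show ?thesis by (simp add: real_sqrt_mult)
qed

lemma E_tendsto:
  assumes s: "\<And>n. s n \<in> D" and u: "u \<in> D" and v: "v \<in> D"
    and lim: "(\<lambda>n::nat. E (s n - u) (s n - u)) \<longlonglongrightarrow> 0"
  shows "(\<lambda>n. E (s n) v) \<longlonglongrightarrow> E u v"
proof -
  have d: "s n - u \<in> D" for n by (intro subspace_diff subspace_D s u)
  have "(\<lambda>n. E (s n) v - E u v) \<longlonglongrightarrow> 0"
  proof (rule Lim_null_comparison)
    have "(\<lambda>n. sqrt (E (s n - u) (s n - u)) * sqrt (E v v)) \<longlonglongrightarrow> sqrt 0 * sqrt (E v v)"
      by (intro tendsto_intros lim)
    then show "(\<lambda>n. sqrt (E (s n - u) (s n - u)) * sqrt (E v v)) \<longlonglongrightarrow> 0" by simp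
    show "\<forall>\<^sub>F n in sequentially. norm (E (s n) v - E u v) \<le> sqrt (E (s n - u) (s n - u)) * sqrt (E v v)"
      using E_Cauchy_Schwarz[OF d v] by (simp add: E_diff_left[OF s u v])
  qed
  then show ?thesis by (simp add: LIM_zero_iff)
qed

lemma energy1_diff_le:
  assumes "x \<in> D" "y \<in> D"
  shows "energy1 E (x - y) \<le> 2 * energy1 E x + 2 * energy1 E y"
proof -
  have E: "E (x - y) (x - y) + E (x + y) (x + y) = 2 * E x x + 2 * E y y"
    using assms subspace_add[OF subspace_D assms] subspace_diff[OF subspace_D assms]
    by (simp add: E_diff_left E_diff_right E_add E_add_right)
  have "inner (x - y) (x - y) + inner (x + y) (x + y) = 2 * inner x x + 2 * inner y y"
    by (simp add: inner_diff_left inner_diff_right inner_add_left inner_add_right)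
  then have "inner (x - y) (x - y) \<le> 2 * inner x x + 2 * inner y y"
    by (metis inner_ge_zero le_add_same_cancel1)
  moreover have "0 \<le> E (x + y) (x + y)" by (intro E_nonneg subspace_add subspace_D assms)
  with E have "E (x - y) (x - y) \<le> 2 * E x x + 2 * E y y" by linarith
  ultimately have "E (x - y) (x - y) + inner (x - y) (x - y)
      \<le> (2 * E x x + 2 * E y y) + (2 * inner x x + 2 * inner y y)"
    by (intro add_mono)
  also have "\<dots> = 2 * (E x x + inner x x) + 2 * (E y y + inner y y)" by simp
  finally show ?thesis by (simp only: energy1_def)
qed

end

context one_forms
begin

text \<open>
  The graph of \<open>f \<mapsto> f \<otimes> 1\<close> on \<open>C\<^sub>b(X) \<inter> Dom E\<close>, before taking the closure.
\<close>

definition core :: "('l \<times> 'h) set" where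
  "core = {(cls f, tens f (\<lambda>x. 1)) | f. f \<in> Cb_dom M cls D}"

lemma ext_deriv_eq: "ext_deriv M cls D tens = closure core"
  by (simp add: ext_deriv_def core_def)

lemma one_bounded_borel: "(\<lambda>x. 1) \<in> bounded_borel"
  by (auto simp: bounded_borel_def)

lemma inner_core:
  assumes "(u, w) \<in> core" "(v, z) \<in> core"
  shows "u \<in> D" and "inner w z = E u v"
proof -
  obtain f g where fg: "f \<in> Cb_dom M cls D" "g \<in> Cb_dom M cls D"
    "u = cls f" "w = tens f (\<lambda>x. 1)" "v = cls g" "z = tens g (\<lambda>x. 1)"
    using assms unfolding core_def by auto
  then show "u \<in> D" by (simp add: Cb_dom_def)
  have "inner w z = (\<integral>x. 1 * 1 * \<Gamma> (cls f) (cls g) x \<partial>M)"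
    unfolding fg(4,6) by (intro inner_tens fg one_bounded_borel)
  also have "\<dots> = E u v"
    using fg by (simp add: Cb_dom_def E_eq_\<Gamma>)
  finally show "inner w z = E u v" .
qed

lemma subspace_core: "subspace core"
proof (rule subspaceI)
  have z: "(\<lambda>x. 0) \<in> Cb_dom M cls D"
    using cls_scale[of "\<lambda>x. 0" 0] subspace_0[OF subspace_D]
    by (auto simp: Cb_dom_def sq_integrable_def)
  have "cls (\<lambda>x. 0) = 0" "tens (\<lambda>x. 0) (\<lambda>x. 1) = 0"
    using cls_scale[of "\<lambda>x. 0" 0] tens_scale_left[OF z one_bounded_borel, of 0]
    by (simp_all add: sq_integrable_def)
  then show "0 \<in> core" using z unfolding core_def zero_prod_def by force
next
  fix p q assume "p \<in> core" "q \<in> core"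
  then obtain f g where f: "f \<in> Cb_dom M cls D" "p = (cls f, tens f (\<lambda>x. 1))"
    and g: "g \<in> Cb_dom M cls D" "q = (cls g, tens g (\<lambda>x. 1))"
    unfolding core_def by auto
  have "p + q = (cls (\<lambda>x. f x + g x), tens (\<lambda>x. f x + g x) (\<lambda>x. 1))"
    using f g by (simp add: tens_add_left one_bounded_borel cls_add Cb_dom_def)
  then show "p + q \<in> core" using Cb_dom_add[OF f(1) g(1)] unfolding core_def by blast
next
  fix c p assume "p \<in> core"
  then obtain f where f: "f \<in> Cb_dom M cls D" "p = (cls f, tens f (\<lambda>x. 1))"
    unfolding core_def by auto
  have "c *\<^sub>R p = (cls (\<lambda>x. c * f x), tens (\<lambda>x. c * f x) (\<lambda>x. 1))"
    using f by (simp add: tens_scale_left one_bounded_borel cls_scale Cb_dom_def)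
  then show "c *\<^sub>R p \<in> core" using Cb_dom_scale[OF f(1)] unfolding core_def by blast
qed

text \<open>
  The energy norm is the graph norm of \<open>f \<mapsto> f \<otimes> 1\<close>; convergence in the one is convergence in the
  other.
\<close>

lemma energy1_core:
  assumes "(u, w) \<in> core" "(v, z) \<in> core"
  shows "energy1 E (u - v) = (norm ((u, w) - (v, z)))\<^sup>2"
proof -
  have "(u - v, w - z) \<in> core" using subspace_diff[OF subspace_core assms] by simp
  from inner_core(2)[OF this this] show ?thesis
    unfolding power2_norm_eq_inner by (simp add: energy1_def)
qed

text \<open>
  A graph-norm limit of core elements is a limit in the energy norm: closedness of the form provides
  an energy limit in \<open>D\<close>, which is \<open>u\<close> because the energy norm dominates the norm.
\<close>

lemma ext_deriv_sequence:
  assumes "(u, w) \<in> ext_deriv M cls D tens"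
  obtains s r where "\<And>n. (s n, r n) \<in> core" "s \<longlonglongrightarrow> u" "r \<longlonglongrightarrow> w" "u \<in> D"
    "(\<lambda>n. E (s n - u) (s n - u)) \<longlonglongrightarrow> 0"
proof -
  have "(u, w) \<in> closure core" using assms unfolding ext_deriv_eq .
  then obtain p where p: "\<forall>n. p n \<in> core" "p \<longlonglongrightarrow> (u, w)"
    unfolding closure_sequential by (elim exE conjE)
  define s r where "s n = fst (p n)" and "r n = snd (p n)" for n
  have sr: "(s n, r n) \<in> core" for n using p(1) by (simp add: s_def r_def)
  have s: "s \<longlonglongrightarrow> u" and r: "r \<longlonglongrightarrow> w"
    using tendsto_fst[OF p(2)] tendsto_snd[OF p(2)] by (simp_all add: s_def[abs_def] r_def[abs_def])
  have sD: "s n \<in> D" for n using inner_core(1)[OF sr sr] .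
  have "\<exists>v\<in>D. (\<lambda>n. energy1 E (s n - v)) \<longlonglongrightarrow> 0"
  proof (rule E_closed[OF sD])
    fix e :: real assume e: "e > 0"
    have "Cauchy p" using p(2) by (rule LIMSEQ_imp_Cauchy)
    moreover have "sqrt e > 0" using e by simp
    ultimately obtain N where N: "\<forall>m\<ge>N. \<forall>n\<ge>N. dist (p m) (p n) < sqrt e"
      using metric_CauchyD by blast
    have "energy1 E (s m - s n) < e" if "m \<ge> N" "n \<ge> N" for m n
    proof -
      have "energy1 E (s m - s n) = (dist (p m) (p n))\<^sup>2"
        unfolding energy1_core[OF sr sr] by (simp add: s_def r_def dist_norm)
      also have "\<dots> < (sqrt e)\<^sup>2"
        using N that by (intro power_strict_mono) auto
      finally show ?thesis using e by simp
    qed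
    then show "\<exists>N. \<forall>m\<ge>N. \<forall>n\<ge>N. energy1 E (s m - s n) < e" by blast
  qed
  then obtain v where v: "v \<in> D" "(\<lambda>n. energy1 E (s n - v)) \<longlonglongrightarrow> 0" by blast
  have dD: "s n - v \<in> D" for n by (intro subspace_diff subspace_D sD v)
  have "(\<lambda>n. (norm (s n - v))\<^sup>2) \<longlonglongrightarrow> 0"
    by (rule tendsto_sandwich[OF _ _ tendsto_const v(2)])
      (use E_nonneg[OF dD] in \<open>auto simp: energy1_def power2_norm_eq_inner\<close>)
  then have "(\<lambda>n. sqrt ((norm (s n - v))\<^sup>2)) \<longlonglongrightarrow> sqrt 0" by (rule tendsto_real_sqrt)
  then have "(\<lambda>n. s n - v) \<longlonglongrightarrow> 0" by (simp add: tendsto_norm_zero_iff)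
  then have "s \<longlonglongrightarrow> v" by (simp add: LIM_zero_iff)
  then have uv: "v = u" using s LIMSEQ_unique by blast
  have "(\<lambda>n. E (s n - u) (s n - u)) \<longlonglongrightarrow> 0"
    by (rule tendsto_sandwich[OF _ _ tendsto_const v(2)[unfolded uv]])
      (use E_nonneg[OF dD] in \<open>auto simp: energy1_def uv\<close>)
  then show thesis using that[OF sr s r] v(1) uv by simp
qed

lemma inner_ext_deriv:
  assumes uw: "(u, w) \<in> ext_deriv M cls D tens" and vz: "(v, z) \<in> ext_deriv M cls D tens"
  shows "inner w z = E u v"
proof -
  obtain s r where s: "\<And>n. (s n, r n) \<in> core" "s \<longlonglongrightarrow> u" "r \<longlonglongrightarrow> w" "u \<in> D"
    "(\<lambda>n. E (s n - u) (s n - u)) \<longlonglongrightarrow> 0" using ext_deriv_sequence[OF uw] by blast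
  obtain s' r' where s': "\<And>n. (s' n, r' n) \<in> core" "s' \<longlonglongrightarrow> v" "r' \<longlonglongrightarrow> z" "v \<in> D"
    "(\<lambda>n. E (s' n - v) (s' n - v)) \<longlonglongrightarrow> 0" using ext_deriv_sequence[OF vz] by blast
  have sD: "s n \<in> D" "s' n \<in> D" for n
    using inner_core(1)[OF s(1) s(1)] inner_core(1)[OF s'(1) s'(1)] by auto
  have 1: "inner w (r' m) = E u (s' m)" for m
  proof (rule LIMSEQ_unique)
    show "(\<lambda>n. inner (r n) (r' m)) \<longlonglongrightarrow> inner w (r' m)" by (intro tendsto_intros s)
    show "(\<lambda>n. inner (r n) (r' m)) \<longlonglongrightarrow> E u (s' m)"
      unfolding inner_core(2)[OF s(1) s'(1)] by (rule E_tendsto[OF sD(1) s(4) sD(2) s(5)])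
  qed
  show ?thesis
  proof (rule LIMSEQ_unique)
    show "(\<lambda>m. inner w (r' m)) \<longlonglongrightarrow> inner w z" by (intro tendsto_intros s')
    show "(\<lambda>m. inner w (r' m)) \<longlonglongrightarrow> E u v"
      unfolding 1 using E_tendsto[OF sD(2) s'(4) s(4) s'(5)]
      by (simp add: E_sym[OF s(4) s'(4)] E_sym[OF s(4) sD(2)])
  qed
qed

lemma energy1_diff_le:
  assumes "x \<in> D" "y \<in> D"
  shows "energy1 E (x - y) \<le> 2 * energy1 E x + 2 * energy1 E y"
proof -
  have E: "E (x - y) (x - y) + E (x + y) (x + y) = 2 * E x x + 2 * E y y"
    using assms subspace_add[OF subspace_D assms] subspace_diff[OF subspace_D assms]
    by (simp add: E_diff_left E_diff_right E_add E_add_right)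
  have "inner (x - y) (x - y) + inner (x + y) (x + y) = 2 * inner x x + 2 * inner y y"
    by (simp add: inner_diff_left inner_diff_right inner_add_left inner_add_right)
  then have "inner (x - y) (x - y) \<le> 2 * inner x x + 2 * inner y y"
    by (metis inner_ge_zero le_add_same_cancel1)
  moreover have "0 \<le> E (x + y) (x + y)" by (intro E_nonneg subspace_add subspace_D assms)
  with E have "E (x - y) (x - y) \<le> 2 * E x x + 2 * E y y" by linarith
  ultimately have "E (x - y) (x - y) + inner (x - y) (x - y)
      \<le> (2 * E x x + 2 * E y y) + (2 * inner x x + 2 * inner y y)"
    by (intro add_mono)
  also have "\<dots> = 2 * (E x x + inner x x) + 2 * (E y y + inner y y)" by simp
  finally show ?thesis by (simp only: energy1_def)
qed

text \<open>
  Regularity of the form approximates each \<open>u\<close> in \<open>D\<close> in energy by functions from \<^const>\<open>Cc\<close>, whose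
  derivatives then form a Cauchy sequence.
\<close>

lemma Domain_ext_deriv: "Domain (ext_deriv M cls D tens) = D"
proof
  show "Domain (ext_deriv M cls D tens) \<subseteq> D"
    using ext_deriv_sequence by blast
  show "D \<subseteq> Domain (ext_deriv M cls D tens)"
  proof
    fix u assume u: "u \<in> D"
    have "\<exists>g\<in>Cc. cls g \<in> D \<and> energy1 E (u - cls g) < 1 / Suc n" for n
      by (rule regular_energy[OF u]) simp
    then obtain g where g: "\<And>n. g n \<in> Cc" "\<And>n. cls (g n) \<in> D"
      "\<And>n. energy1 E (u - cls (g n)) < 1 / Suc n" by metis
    have gC: "g n \<in> Cb_dom M cls D" for n
      using g(1,2)[of n] Cc_bounded[OF g(1)] Cc_sq_integrable[OF g(1)] by (simp add: Cb_dom_def Cc_def)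
    define p where "p n = (cls (g n), tens (g n) (\<lambda>x. 1))" for n
    have p: "p n \<in> core" for n using gC unfolding p_def core_def by blast
    have uD: "u - cls (g n) \<in> D" for n by (intro subspace_diff subspace_D u g)
    have "(dist (p i) (p j))\<^sup>2 \<le> 2 / Suc i + 2 / Suc j" for i j
    proof -
      have "(dist (p i) (p j))\<^sup>2 = energy1 E (cls (g i) - cls (g j))"
        using energy1_core[OF p[unfolded p_def] p[unfolded p_def]] by (simp add: p_def dist_norm)
      also have "cls (g i) - cls (g j) = (u - cls (g j)) - (u - cls (g i))" by simp
      also have "energy1 E \<dots> \<le> 2 * energy1 E (u - cls (g j)) + 2 * energy1 E (u - cls (g i))"
        by (rule energy1_diff_le[OF uD uD])
      also have "\<dots> \<le> 2 * (1 / Suc j) + 2 * (1 / Suc i)"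
        by (intro add_mono mult_left_mono less_imp_le[OF g(3)]) simp_all
      finally show ?thesis by simp
    qed
    then have "Cauchy p" by (rule Cauchy_if_square_dist_le)
    then obtain q where q: "p \<longlonglongrightarrow> q" using Cauchy_convergent_iff convergent_def by blast
    have "q \<in> ext_deriv M cls D tens"
      unfolding ext_deriv_eq closure_sequential using p q by blast
    moreover have "fst q = u"
    proof (rule LIMSEQ_unique)
      show "(\<lambda>n. cls (g n)) \<longlonglongrightarrow> fst q" using tendsto_fst[OF q] by (simp add: p_def)
      have "(\<lambda>n. (norm (u - cls (g n)))\<^sup>2) \<longlonglongrightarrow> 0"
      proof (rule tendsto_sandwich[OF _ _ tendsto_const LIMSEQ_inverse_real_of_nat])
        show "\<forall>\<^sub>F n in sequentially. (norm (u - cls (g n)))\<^sup>2 \<le> inverse (real (Suc n))"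
        proof (rule always_eventually, rule allI)
          fix n
          show "(norm (u - cls (g n)))\<^sup>2 \<le> inverse (real (Suc n))"
            using g(3)[of n] E_nonneg[OF uD[of n]]
            unfolding energy1_def power2_norm_eq_inner inverse_eq_divide by linarith
        qed
      qed simp
      then have "(\<lambda>n. sqrt ((norm (u - cls (g n)))\<^sup>2)) \<longlonglongrightarrow> sqrt 0" by (rule tendsto_real_sqrt)
      then have "(\<lambda>n. cls (g n) - u) \<longlonglongrightarrow> 0"
        by (simp add: tendsto_norm_zero_iff norm_minus_commute[of u])
      then show "(\<lambda>n. cls (g n)) \<longlonglongrightarrow> u" by (simp add: LIM_zero_iff)
    qed
    ultimately show "u \<in> Domain (ext_deriv M cls D tens)" by (metis Domain.DomainI prod.collapse)
  qed
qed

lemma closed_densely_defined_ext_deriv: "closed_densely_defined (ext_deriv M cls D tens)"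
proof
  show "subspace (ext_deriv M cls D tens)"
    unfolding ext_deriv_eq by (rule subspace_closure[OF subspace_core])
  show "closed (ext_deriv M cls D tens)" unfolding ext_deriv_eq by simp
  show "closure (Domain (ext_deriv M cls D tens)) = UNIV" unfolding Domain_ext_deriv by (rule dense_D)
  fix w assume w: "(0, w) \<in> ext_deriv M cls D tens"
  have "E 0 0 = 0"
    using E_scale[of 0 0 0] subspace_0[OF subspace_D] by simp
  then show "w = 0" using inner_ext_deriv[OF w w] by simp
qed

lemma laplacian_eq_form_laplacian: "laplacian D E = form_laplacian (op_adjoint (ext_deriv M cls D tens))"
proof -
  interpret closed_densely_defined "ext_deriv M cls D tens" by (rule closed_densely_defined_ext_deriv)
  have "(u, w) \<in> laplacian D E
      \<longleftrightarrow> (\<exists>p. (u, p) \<in> ext_deriv M cls D tens \<and> (p, - w) \<in> op_adjoint (ext_deriv M cls D tens))" for u w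
  proof
    assume "(u, w) \<in> laplacian D E"
    then have u: "u \<in> D" and E: "\<And>v. v \<in> D \<Longrightarrow> E u v = - inner v w" by (auto simp: laplacian_def)
    obtain p where p: "(u, p) \<in> ext_deriv M cls D tens" using u Domain_ext_deriv by blast
    have "inner q p = inner v (- w)" if vq: "(v, q) \<in> ext_deriv M cls D tens" for v q
    proof -
      have "v \<in> D" using vq Domain_ext_deriv by blast
      then show ?thesis using inner_ext_deriv[OF p vq] E by (simp add: inner_commute)
    qed
    then show "\<exists>p. (u, p) \<in> ext_deriv M cls D tens \<and> (p, - w) \<in> op_adjoint (ext_deriv M cls D tens)"
      using p by (auto simp: op_adjoint_iff)
  next
    assume "\<exists>p. (u, p) \<in> ext_deriv M cls D tens \<and> (p, - w) \<in> op_adjoint (ext_deriv M cls D tens)"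
    then obtain p where p: "(u, p) \<in> ext_deriv M cls D tens"
      and w: "(p, - w) \<in> op_adjoint (ext_deriv M cls D tens)" by (elim exE conjE)
    have "E u v = - inner v w" if "v \<in> D" for v
    proof -
      have "v \<in> Domain (ext_deriv M cls D tens)" using that unfolding Domain_ext_deriv .
      then obtain q where q: "(v, q) \<in> ext_deriv M cls D tens" by (rule DomainE)
      have "E u v = inner q p" using inner_ext_deriv[OF p q] by (simp only: inner_commute)
      also have "\<dots> = inner v (- w)" by (rule op_adjointD[OF w q])
      finally show ?thesis by simp
    qed
    moreover have "u \<in> D" using p Domain_ext_deriv by blast
    ultimately show "(u, w) \<in> laplacian D E" by (simp add: laplacian_def)
  qed
  moreover have "(u, w) \<in> form_laplacian (op_adjoint (ext_deriv M cls D tens))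
      \<longleftrightarrow> (\<exists>p. (u, p) \<in> ext_deriv M cls D tens \<and> (p, - w) \<in> op_adjoint (ext_deriv M cls D tens))" for u w
    by (rule form_laplacian_adjoint_iff)
  ultimately show ?thesis by (intro set_eqI) (simp only: split_paired_all)
qed

end

theorem theorem2p1:
  fixes M :: "'x::metric_space measure"
    and cls :: "('x \<Rightarrow> real) \<Rightarrow> 'l::{real_inner, complete_space}"
    and D :: "'l set"
    and E :: "'l \<Rightarrow> 'l \<Rightarrow> real"
    and \<Gamma> :: "'l \<Rightarrow> 'l \<Rightarrow> 'x \<Rightarrow> real"
    and tens :: "('x \<Rightarrow> real) \<Rightarrow> ('x \<Rightarrow> real) \<Rightarrow> 'h::{real_inner, complete_space}"
    and f :: 'l and t :: real
  defines "d \<equiv> ext_deriv M cls D tens"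
  assumes "one_forms M cls D E \<Gamma> tens"
    and "f \<in> D" and "t \<ge> 0"
  shows "op_exp t (laplacian D E) f \<in> Domain d \<and>
         op_app d (op_exp t (laplacian D E) f) = op_exp t (form_laplacian d) (op_app d f)"
proof -
  interpret one_forms M cls D E \<Gamma> tens by fact
  interpret d: closed_densely_defined d
    unfolding d_def by (rule closed_densely_defined_ext_deriv)
  obtain g where g: "(f, g) \<in> d"
    using \<open>f \<in> D\<close> Domain_ext_deriv unfolding d_def by blast
  have "(op_exp t (laplacian D E) f, op_exp t (form_laplacian d) g) \<in> d"
    using d.op_exp_intertwine_form_laplacian[OF g \<open>t \<ge> 0\<close>]
    unfolding laplacian_eq_form_laplacian d_def .
  then show ?thesis using d.op_app_eqI g by auto
qed

end
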